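(* Let $\mathfrak{R}$ be an expansion of $(\mathbb{R},<,+)$ that defines a discrete set $D \subseteq \mathbb{R}^k$ (for some $k$) and a map $f: D \to \mathbb{R}$ whose image is somewhere dense. Then $\mathfrak{R}$ defines $\mathcal{B}$.
   Context: A set $D\subseteq\mathbb{R}^k$ is discrete if every point of $D$ is isolated in $D$ (subspace topology). A subset of $\mathbb{R}$ is somewhere dense if it is dense in some nonempty open interval. $\mathcal{B}$ denotes the two-sorted first order structure $(\mathcal{P}(\mathbb{N}),\mathbb{N},\in,+1)$, where $\mathcal{P}(\mathbb{N})$ is the power set of $\mathbb{N}$, $\in$ is the membership relation between $\mathbb{N}$ and $\mathcal{P}(\mathbb{N})$, and $+1$ is the successor function on $\mathbb{N}$. "Definable" means first order definable with parameters. A structure with underlying set $\mathbb{R}$ "defines $\mathcal{B}$" if it defines an isomorphic copy of $\mathcal{B}$: there are definable sets $N', P'$ (subsets of Cartesian powers of $\mathbb{R}$), a definable relation $\epsilon \subseteq N' \times P'$ and a definable function $s: N' \to N'$ such that the two-sorted structure $(P',N',\epsilon,s)$ is isomorphic to $\mathcal{B}$. *)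

theory Defs
  imports "HOL-Analysis.Analysis"
begin

section \<open>First-order structures and definability with parameters\<close>

text \<open>
  A one-sorted structure whose universe is the whole type \<open>'a\<close>. The function and relation symbols
  are the elements of \<open>'f\<close> and \<open>'r\<close>; the interpretation of a symbol is only ever consulted on
  argument lists whose length is its arity.
\<close>

record ('f, 'r, 'a) fo_struct =
  farity :: "'f \<Rightarrow> nat"
  rarity :: "'r \<Rightarrow> nat"
  finterp :: "'f \<Rightarrow> 'a list \<Rightarrow> 'a"
  rinterp :: "'r \<Rightarrow> 'a list \<Rightarrow> bool"

datatype 'f fo_term = Var nat | App 'f "'f fo_term list"

text \<open>Variables are de Bruijn indices: \<open>Exists\<close> binds index 0 and shifts the others up.\<close>

datatype ('f, 'r) fo_formula =
    Eq "'f fo_term" "'f fo_term"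
  | Rel 'r "'f fo_term list"
  | Neg "('f, 'r) fo_formula"
  | Conj "('f, 'r) fo_formula" "('f, 'r) fo_formula"
  | Exists "('f, 'r) fo_formula"

fun wf_term :: "('f, 'r, 'a) fo_struct \<Rightarrow> 'f fo_term \<Rightarrow> bool" where
  "wf_term M (Var i) \<longleftrightarrow> True"
| "wf_term M (App f ts) \<longleftrightarrow> length ts = farity M f \<and> (\<forall>t\<in>set ts. wf_term M t)"

fun wf_formula :: "('f, 'r, 'a) fo_struct \<Rightarrow> ('f, 'r) fo_formula \<Rightarrow> bool" where
  "wf_formula M (Eq t u) \<longleftrightarrow> wf_term M t \<and> wf_term M u"
| "wf_formula M (Rel R ts) \<longleftrightarrow> length ts = rarity M R \<and> (\<forall>t\<in>set ts. wf_term M t)"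
| "wf_formula M (Neg \<phi>) \<longleftrightarrow> wf_formula M \<phi>"
| "wf_formula M (Conj \<phi> \<psi>) \<longleftrightarrow> wf_formula M \<phi> \<and> wf_formula M \<psi>"
| "wf_formula M (Exists \<phi>) \<longleftrightarrow> wf_formula M \<phi>"

fun eval_term :: "('f, 'r, 'a) fo_struct \<Rightarrow> (nat \<Rightarrow> 'a) \<Rightarrow> 'f fo_term \<Rightarrow> 'a" where
  "eval_term M e (Var i) = e i"
| "eval_term M e (App f ts) = finterp M f (map (eval_term M e) ts)"

fun sat :: "('f, 'r, 'a) fo_struct \<Rightarrow> (nat \<Rightarrow> 'a) \<Rightarrow> ('f, 'r) fo_formula \<Rightarrow> bool" where
  "sat M e (Eq t u) \<longleftrightarrow> eval_term M e t = eval_term M e u"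
| "sat M e (Rel R ts) \<longleftrightarrow> rinterp M R (map (eval_term M e) ts)"
| "sat M e (Neg \<phi>) \<longleftrightarrow> \<not> sat M e \<phi>"
| "sat M e (Conj \<phi> \<psi>) \<longleftrightarrow> sat M e \<phi> \<and> sat M e \<psi>"
| "sat M e (Exists \<phi>) \<longleftrightarrow> (\<exists>a. sat M (case_nat a e) \<phi>)"

text \<open>
  Points of \<open>\<real>\<^sup>k\<close> are represented as in \<^const>\<open>Euclidean_space\<close>: functions \<open>nat \<Rightarrow> real\<close>
  vanishing from index \<open>k\<close> on.
\<close>

abbreviation Rpow :: "nat \<Rightarrow> (nat \<Rightarrow> real) set" where
  "Rpow k \<equiv> topspace (Euclidean_space k)"

text \<open>The concatenation of a point of \<open>\<real>\<^sup>m\<close> with a point of \<open>\<real>\<^sup>n\<close>, as a point of \<open>\<real>\<^sup>m\<^sup>+\<^sup>n\<close>.\<close>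

definition tuple_append :: "nat \<Rightarrow> (nat \<Rightarrow> 'a) \<Rightarrow> (nat \<Rightarrow> 'a) \<Rightarrow> nat \<Rightarrow> 'a" where
  "tuple_append m x y = (\<lambda>i. if i < m then x i else y (i - m))"

definition real_point :: "real \<Rightarrow> nat \<Rightarrow> real" where
  "real_point r = (\<lambda>i. if i = 0 then r else 0)"

text \<open>
  The free variables below \<open>k\<close> stand for the coordinates, those from \<open>k\<close> on for the parameters \<open>p\<close>;
  a formula mentions only finitely many of the latter.
\<close>

definition definable ::
    "('f, 'r, real) fo_struct \<Rightarrow> nat \<Rightarrow> (nat \<Rightarrow> real) set \<Rightarrow> bool" where
  "definable M k X \<longleftrightarrow>
     (\<exists>\<phi> p. wf_formula M \<phi> \<and> X = {x \<in> Rpow k. sat M (tuple_append k x p) \<phi>})"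

definition definable_rel ::
    "('f, 'r, real) fo_struct \<Rightarrow> nat \<Rightarrow> nat \<Rightarrow> ((nat \<Rightarrow> real) \<times> (nat \<Rightarrow> real)) set \<Rightarrow> bool" where
  "definable_rel M m n E \<longleftrightarrow>
     E \<subseteq> Rpow m \<times> Rpow n \<and> definable M (m + n) ((\<lambda>(x, y). tuple_append m x y) ` E)"

definition definable_map ::
    "('f, 'r, real) fo_struct \<Rightarrow> nat \<Rightarrow> nat \<Rightarrow> (nat \<Rightarrow> real) set
      \<Rightarrow> ((nat \<Rightarrow> real) \<Rightarrow> nat \<Rightarrow> real) \<Rightarrow> bool" where
  "definable_map M m n A g \<longleftrightarrow> definable_rel M m n ((\<lambda>x. (x, g x)) ` A)"

text \<open>\<open>M\<close> is an expansion of \<open>(\<real>, <, +)\<close>; the rest of its language is arbitrary.\<close>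

definition expands_real_ordered_group :: "('f, 'r, real) fo_struct \<Rightarrow> bool" where
  "expands_real_ordered_group M \<longleftrightarrow>
     (\<exists>R. rarity M R = 2 \<and> (\<forall>x y. rinterp M R [x, y] \<longleftrightarrow> x < y)) \<and>
     (\<exists>f. farity M f = 2 \<and> (\<forall>x y. finterp M f [x, y] = x + y))"

section \<open>The two-sorted structure \<open>(\<P>(\<nat>), \<nat>, \<in>, +1)\<close> and its definable copies\<close>

record ('p, 'n) mso_struct =
  psort :: "'p set"
  nsort :: "'n set"
  memrel :: "('n \<times> 'p) set"
  nsucc :: "'n \<Rightarrow> 'n"

definition mso_iso :: "('p, 'n) mso_struct \<Rightarrow> ('q, 'm) mso_struct \<Rightarrow> bool" where
  "mso_iso A B \<longleftrightarrow>
     (\<exists>g h. bij_betw g (psort A) (psort B) \<and> bij_betw h (nsort A) (nsort B) \<and>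
        (\<forall>x\<in>nsort A. \<forall>X\<in>psort A. (x, X) \<in> memrel A \<longleftrightarrow> (h x, g X) \<in> memrel B) \<and>
        (\<forall>x\<in>nsort A. h (nsucc A x) = nsucc B (h x)))"

definition structB :: "(nat set, nat) mso_struct" where
  "structB = \<lparr>psort = UNIV, nsort = UNIV, memrel = {(x, X). x \<in> X}, nsucc = Suc\<rparr>"

definition defines_B :: "('f, 'r, real) fo_struct \<Rightarrow> bool" where
  "defines_B M \<longleftrightarrow>
     (\<exists>p n P N E s.
        definable M p P \<and> definable M n N \<and>
        E \<subseteq> N \<times> P \<and> definable_rel M n p E \<and>
        s ` N \<subseteq> N \<and> definable_map M n n N s \<and>
        mso_iso \<lparr>psort = P, nsort = N, memrel = E, nsucc = s\<rparr> structB)"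

section \<open>Topological notions\<close>

definition discrete_in_Rpow :: "nat \<Rightarrow> (nat \<Rightarrow> real) set \<Rightarrow> bool" where
  "discrete_in_Rpow k D \<longleftrightarrow>
     D \<subseteq> Rpow k \<and> (\<forall>x\<in>D. openin (subtopology (Euclidean_space k) D) {x})"

definition somewhere_dense :: "real set \<Rightarrow> bool" where
  "somewhere_dense S \<longleftrightarrow>
     (\<exists>I. open I \<and> is_interval I \<and> I \<noteq> {} \<and> I \<subseteq> closure (S \<inter> I))"

end

theory Submission
  imports Defs
begin

text \<open>
  A subset of \<open>\<nat>\<close> is coded by a single real number, read off against a dense set that is swept out
  by finite sets.

  Suppose that a set \<open>S\<close> of reals, dense in an interval, carries a definable total preorder all of
  whose initial segments are finite.  Cutting the interval at larger and larger initial segments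
  gives a sequence of finer and finer finite partitions.  Among the initial segments one can choose
  a sequence such that between two consecutive points of one of them there are at least two points
  of the next one.  The parts that contain a real number \<open>c\<close> are then obtained by successive choices,
  each of which allows two options independently of the earlier ones, and \<open>c\<close> is determined by its
  choices because \<open>S\<close> is dense.  So the numbers \<open>c\<close> with admissible choices are in bijection with the
  subsets of \<open>\<nat>\<close> (\<open>bij_decode\<close>).

  The difficulty is that the sequence of initial segments must itself be definable, although it is
  chosen by recursion.  It is obtained as the set of best approximations from below of one
  suitable parameter \<open>c0\<close>: the points \<open>d \<in> S\<close> below \<open>c0\<close> such that no point of \<open>S\<close> that comes
  earlier or at the same time lies strictly between \<open>d\<close> and \<open>c0\<close>.  By moving \<open>c0\<close> extremely close
  to one best approximation, the next one can be delayed as long as one likes (\<open>sparse_scale\<close>).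
  This uses the order of the real line only (\<open>defines_B_if_dense_finitary_preorder\<close>).

  Addition serves to produce such a preorder from a discrete set \<open>D\<close>.  The points of \<open>D\<close> in a cube
  of size \<open>R\<close> whose distance to the rest of \<open>D\<close> is at least \<open>t\<close> are finite in number.  Their images under \<open>f\<close>
  form a family of finite sets with two parameters, and it has to be replaced by one that is
  linearly ordered by inclusion.  If fixing one of the parameters leaves a somewhere dense union,
  the other parameter does this.  Otherwise each of the two unions has a gap of positive length, and
  the lengths of the gaps measure \<open>t\<close> and \<open>R\<close> on a common scale (\<open>coarse\<close>).
\<close>

section \<open>Closure properties of definable predicates\<close>

fun rename_term :: "(nat \<Rightarrow> nat) \<Rightarrow> 'f fo_term \<Rightarrow> 'f fo_term" where
  "rename_term r (Var i) = Var (r i)"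
| "rename_term r (App f ts) = App f (map (rename_term r) ts)"

fun rename :: "(nat \<Rightarrow> nat) \<Rightarrow> ('f, 'r) fo_formula \<Rightarrow> ('f, 'r) fo_formula" where
  "rename r (Eq t u) = Eq (rename_term r t) (rename_term r u)"
| "rename r (Rel R ts) = Rel R (map (rename_term r) ts)"
| "rename r (Neg \<phi>) = Neg (rename r \<phi>)"
| "rename r (Conj \<phi> \<psi>) = Conj (rename r \<phi>) (rename r \<psi>)"
| "rename r (Exists \<phi>) = Exists (rename (case_nat 0 (\<lambda>i. Suc (r i))) \<phi>)"

lemma wf_rename_term: "wf_term M t \<Longrightarrow> wf_term M (rename_term r t)"
  by (induction t) auto

lemma eval_rename_term: "eval_term M e (rename_term r t) = eval_term M (\<lambda>i. e (r i)) t"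
proof (induction t)
  case (App f ts)
  then have "map (eval_term M e) (map (rename_term r) ts) = map (eval_term M (\<lambda>i. e (r i))) ts"
    by simp
  then show ?case by (simp del: map_map)
qed simp

lemma wf_rename: "wf_formula M \<phi> \<Longrightarrow> wf_formula M (rename r \<phi>)"
  by (induction \<phi> arbitrary: r) (auto simp: wf_rename_term)

lemma sat_rename: "sat M e (rename r \<phi>) \<longleftrightarrow> sat M (\<lambda>i. e (r i)) \<phi>"
proof (induction \<phi> arbitrary: r e)
  case (Eq t u)
  show ?case by (simp add: eval_rename_term)
next
  case (Rel R ts)
  show ?case by (simp add: eval_rename_term comp_def)
next
  case (Exists \<phi>)
  have "(\<lambda>i. case_nat a e (case_nat 0 (\<lambda>i. Suc (r i)) i)) = case_nat a (\<lambda>i. e (r i))" for a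
    by (auto split: nat.split)
  then show ?case by (simp add: Exists)
qed auto

definition coordinate_or_constant :: "((nat \<Rightarrow> real) \<Rightarrow> real) \<Rightarrow> bool" where
  "coordinate_or_constant v \<longleftrightarrow> (\<exists>j. v = (\<lambda>e. e j)) \<or> (\<exists>c. v = (\<lambda>e. c))"

lemma coordinateI [intro]: "coordinate_or_constant (\<lambda>e. e j)"
  and constantI [intro]: "coordinate_or_constant (\<lambda>e. c)"
  by (auto simp: coordinate_or_constant_def)

lemma coordinate_or_constant_compose:
  assumes "coordinate_or_constant v" and "\<And>i. coordinate_or_constant (\<tau> i)"
  shows "coordinate_or_constant (\<lambda>e. v (\<lambda>i. \<tau> i e))"
  using assms(1) unfolding coordinate_or_constant_def[of v]
proof
  assume "\<exists>j. v = (\<lambda>e. e j)"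
  then obtain j where "v = (\<lambda>e. e j)" by blast
  then show ?thesis using assms(2)[of j] by simp
qed auto

text \<open>
  Definability is established for predicates on assignments \<open>e\<close> of all variables, by rules that
  follow the shape of the predicate: \<open>e i\<close> is the variable with de Bruijn index \<open>i\<close>, and parameters
  are literal real numbers.
\<close>
locale ordered_group_expansion =
  fixes M :: "('f, 'r, real) fo_struct"
  assumes expands: "expands_real_ordered_group M"
begin

text \<open>
  The map \<open>\<sigma>\<close> connects the variables of the formula with the entries of \<open>e\<close> and the parameters.
  Because it is arbitrary, the parameters of two formulas can be combined, and variables can be
  substituted, without changes to the formulas other than renaming.
\<close>
definition env_definable :: "((nat \<Rightarrow> real) \<Rightarrow> bool) \<Rightarrow> bool" where
  "env_definable Q \<longleftrightarrow>
     (\<exists>\<phi> \<sigma>. wf_formula M \<phi> \<and> (\<forall>i. coordinate_or_constant (\<sigma> i)) \<and>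
            (\<forall>e. Q e \<longleftrightarrow> sat M (\<lambda>i. \<sigma> i e) \<phi>))"

lemma env_definableI:
  assumes "wf_formula M \<phi>" "\<And>i. coordinate_or_constant (\<sigma> i)" "\<And>e. Q e \<longleftrightarrow> sat M (\<lambda>i. \<sigma> i e) \<phi>"
  shows "env_definable Q"
  using assms unfolding env_definable_def by blast

lemma env_definableE:
  assumes "env_definable Q"
  obtains \<phi> \<sigma> where "wf_formula M \<phi>" "\<And>i. coordinate_or_constant (\<sigma> i)"
    "\<And>e. Q e \<longleftrightarrow> sat M (\<lambda>i. \<sigma> i e) \<phi>"
  using assms unfolding env_definable_def by blast

lemma env_definable_subst:
  assumes "env_definable Q" "\<And>i. coordinate_or_constant (\<tau> i)"
  shows "env_definable (\<lambda>e. Q (\<lambda>i. \<tau> i e))"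
proof -
  obtain \<phi> \<sigma> where \<phi>: "wf_formula M \<phi>" "\<And>i. coordinate_or_constant (\<sigma> i)"
    "\<And>e. Q e \<longleftrightarrow> sat M (\<lambda>i. \<sigma> i e) \<phi>"
    using assms(1) by (rule env_definableE) (rule that)
  show ?thesis
  proof (rule env_definableI[OF \<phi>(1)])
    show "coordinate_or_constant (\<lambda>e. \<sigma> i (\<lambda>i. \<tau> i e))" for i
      by (rule coordinate_or_constant_compose[OF \<phi>(2) assms(2)])
  qed (rule \<phi>(3))
qed

lemma env_definable_not:
  assumes "env_definable Q"
  shows "env_definable (\<lambda>e. \<not> Q e)"
proof -
  obtain \<phi> \<sigma> where "wf_formula M \<phi>" "\<And>i. coordinate_or_constant (\<sigma> i)"
    "\<And>e. Q e \<longleftrightarrow> sat M (\<lambda>i. \<sigma> i e) \<phi>"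
    using assms by (rule env_definableE) (rule that)
  then show ?thesis by (intro env_definableI[of "Neg \<phi>" \<sigma>]) auto
qed

lemma env_definable_conj:
  assumes "env_definable Q" "env_definable Q'"
  shows "env_definable (\<lambda>e. Q e \<and> Q' e)"
proof -
  obtain \<phi> \<sigma> where \<phi>: "wf_formula M \<phi>" "\<And>i. coordinate_or_constant (\<sigma> i)"
    "\<And>e. Q e \<longleftrightarrow> sat M (\<lambda>i. \<sigma> i e) \<phi>"
    using assms(1) by (rule env_definableE) (rule that)
  obtain \<psi> \<tau> where \<psi>: "wf_formula M \<psi>" "\<And>i. coordinate_or_constant (\<tau> i)"
    "\<And>e. Q' e \<longleftrightarrow> sat M (\<lambda>i. \<tau> i e) \<psi>"
    using assms(2) by (rule env_definableE) (rule that)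
  let ?\<chi> = "Conj (rename (\<lambda>i. 2 * i) \<phi>) (rename (\<lambda>i. 2 * i + 1) \<psi>)"
  let ?\<rho> = "\<lambda>i. if even i then \<sigma> (i div 2) else \<tau> (i div 2)"
  show ?thesis
    by (rule env_definableI[of ?\<chi> ?\<rho>]) (auto simp: \<phi> \<psi> wf_rename sat_rename)
qed

text \<open>
  The bound coordinate gets index \<open>0\<close>.  An entry of the assignment \<open>\<sigma>\<close> that reads it is renamed
  to the variable bound by the quantifier; all others do not see the bound value at all, so that
  they may be evaluated with an arbitrary value, here \<open>0\<close>, in its place.
\<close>
lemma env_definable_ex:
  assumes "env_definable (\<lambda>e. Q (\<lambda>i. e (Suc i)) (e 0))"
  shows "env_definable (\<lambda>e. \<exists>x. Q e x)"
proof -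
  obtain \<phi> \<sigma> where \<phi>: "wf_formula M \<phi>" and \<sigma>: "\<And>i. coordinate_or_constant (\<sigma> i)"
    and Q: "\<And>e. Q (\<lambda>i. e (Suc i)) (e 0) \<longleftrightarrow> sat M (\<lambda>i. \<sigma> i e) \<phi>"
    using assms by (rule env_definableE) (rule that)
  let ?r = "\<lambda>i. if \<sigma> i = (\<lambda>e. e 0) then 0 else Suc i"
  let ?\<rho> = "\<lambda>i e. \<sigma> i (case_nat 0 e)"
  have bound: "case_nat x (\<lambda>i. ?\<rho> i e) (?r i) = \<sigma> i (case_nat x e)" for x e i
    using \<sigma>[of i] unfolding coordinate_or_constant_def
    by (auto split: nat.split)
  show ?thesis
  proof (rule env_definableI)
    show "wf_formula M (Exists (rename ?r \<phi>))"
      unfolding wf_formula.simps by (rule wf_rename[OF \<phi>])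
    show "coordinate_or_constant (?\<rho> i)" for i
    proof (rule coordinate_or_constant_compose[OF \<sigma>])
      show "coordinate_or_constant (\<lambda>e. case_nat 0 e j)" for j
        by (cases j) auto
    qed
    show "(\<exists>x. Q e x) \<longleftrightarrow> sat M (\<lambda>i. ?\<rho> i e) (Exists (rename ?r \<phi>))" for e
      unfolding sat.simps sat_rename bound using Q[of "case_nat x e" for x] by simp
  qed
qed

lemma env_definable_disj:
  assumes "env_definable Q" "env_definable Q'"
  shows "env_definable (\<lambda>e. Q e \<or> Q' e)"
  using env_definable_not[OF env_definable_conj[OF assms[THEN env_definable_not]]] by simp

lemma env_definable_imp:
  assumes "env_definable Q" "env_definable Q'"
  shows "env_definable (\<lambda>e. Q e \<longrightarrow> Q' e)"
  unfolding imp_conv_disj by (rule env_definable_disj[OF env_definable_not[OF assms(1)] assms(2)])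

lemma env_definable_all:
  assumes "env_definable (\<lambda>e. Q (\<lambda>i. e (Suc i)) (e 0))"
  shows "env_definable (\<lambda>e. \<forall>x. Q e x)"
proof -
  have "env_definable (\<lambda>e. \<exists>x. \<not> Q e x)"
    by (rule env_definable_ex, rule env_definable_not, rule assms)
  from env_definable_not[OF this] show ?thesis by simp
qed

lemma env_definable_eq:
  assumes "coordinate_or_constant v" "coordinate_or_constant w"
  shows "env_definable (\<lambda>e. v e = w e)"
  by (rule env_definableI[of "Eq (Var 0) (Var 1)" "\<lambda>i. if i = 0 then v else w"])
     (use assms in auto)

lemma env_definable_const: "env_definable (\<lambda>e. b)"
  using env_definable_eq[OF constantI[of 0] constantI[of "if b then 0 else 1"]]
  by (cases b) auto

lemma env_definable_less:
  assumes "coordinate_or_constant v" "coordinate_or_constant w"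
  shows "env_definable (\<lambda>e. v e < w e)"
proof -
  obtain R where "rarity M R = 2" "\<And>x y. rinterp M R [x, y] \<longleftrightarrow> x < y"
    using expands unfolding expands_real_ordered_group_def by blast
  then show ?thesis
    by (intro env_definableI[of "Rel R [Var 0, Var 1]" "\<lambda>i. if i = 0 then v else w"])
       (use assms in auto)
qed

lemma env_definable_add_eq:
  assumes "coordinate_or_constant u" "coordinate_or_constant v" "coordinate_or_constant w"
  shows "env_definable (\<lambda>e. u e + v e = w e)"
proof -
  obtain g where "farity M g = 2" "\<And>x y. finterp M g [x, y] = x + y"
    using expands unfolding expands_real_ordered_group_def by blast
  then show ?thesis
    by (intro env_definableI[of "Eq (App g [Var 0, Var 1]) (Var 2)"
          "\<lambda>i. if i = 0 then u else if i = 1 then v else w"])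
       (use assms in auto)
qed

lemma env_definable_le:
  assumes "coordinate_or_constant v" "coordinate_or_constant w"
  shows "env_definable (\<lambda>e. v e \<le> w e)"
  using env_definable_not[OF env_definable_less[OF assms(2,1)]] by (simp add: not_less)

lemma coordinate_or_constant_shift:
  assumes "coordinate_or_constant v"
  shows "coordinate_or_constant (\<lambda>e. v (\<lambda>i. e (Suc i)))"
  by (rule coordinate_or_constant_compose[OF assms]) auto

lemma env_definable_less_add:
  assumes "coordinate_or_constant u" "coordinate_or_constant v" "coordinate_or_constant w"
  shows "env_definable (\<lambda>e. w e < u e + v e)"
proof -
  have "env_definable (\<lambda>e. \<exists>x. u e + v e = x \<and> w e < x)"
    by (intro env_definable_ex env_definable_conj env_definable_add_eq env_definable_less
          coordinate_or_constant_shift assms coordinateI)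
  then show ?thesis by simp
qed

lemma env_definable_add_le:
  assumes "coordinate_or_constant u" "coordinate_or_constant v" "coordinate_or_constant w"
  shows "env_definable (\<lambda>e. u e + v e \<le> w e)"
  using env_definable_not[OF env_definable_less_add[OF assms]] by (simp add: not_less)

text \<open>
  The predicate is a finite conjunction with one formula for each \<open>i\<close>, rather than a first-order
  quantification.
\<close>
lemma env_definable_ball_less:
  fixes n :: nat
  assumes "\<And>i. i < n \<Longrightarrow> env_definable (Q i)"
  shows "env_definable (\<lambda>e. \<forall>i<n. Q i e)"
  using assms
proof (induction n)
  case 0
  show ?case by (simp add: env_definable_const)
next
  case (Suc n)
  have "env_definable (\<lambda>e. (\<forall>i<n. Q i e) \<and> Q n e)"
    by (intro env_definable_conj Suc) auto
  moreover have "(\<forall>i<Suc n. Q i e) \<longleftrightarrow> (\<forall>i<n. Q i e) \<and> Q n e" for e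
    by (auto simp: less_Suc_eq)
  ultimately show ?case by simp
qed

definition definable1 :: "real set \<Rightarrow> bool" where
  "definable1 S \<longleftrightarrow> env_definable (\<lambda>e. e 0 \<in> S)"

definition definable2 :: "(real \<Rightarrow> real \<Rightarrow> bool) \<Rightarrow> bool" where
  "definable2 R \<longleftrightarrow> env_definable (\<lambda>e. R (e 0) (e 1))"

definition definable3 :: "(real \<Rightarrow> real \<Rightarrow> real \<Rightarrow> bool) \<Rightarrow> bool" where
  "definable3 R \<longleftrightarrow> env_definable (\<lambda>e. R (e 0) (e 1) (e 2))"

lemma env_definable_mem:
  assumes "definable1 S" "coordinate_or_constant v"
  shows "env_definable (\<lambda>e. v e \<in> S)"
  using env_definable_subst[OF assms(1)[unfolded definable1_def], of "\<lambda>i. v"] assms(2) by simp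

lemma env_definable_rel2:
  assumes "definable2 R" "coordinate_or_constant u" "coordinate_or_constant v"
  shows "env_definable (\<lambda>e. R (u e) (v e))"
  using env_definable_subst[OF assms(1)[unfolded definable2_def], of "\<lambda>i. if i = 0 then u else v"]
    assms(2,3) by simp

lemma env_definable_rel3:
  assumes "definable3 R" "coordinate_or_constant u" "coordinate_or_constant v"
    "coordinate_or_constant w"
  shows "env_definable (\<lambda>e. R (u e) (v e) (w e))"
  using env_definable_subst[OF assms(1)[unfolded definable3_def],
      of "\<lambda>i. if i = 0 then u else if i = 1 then v else w"] assms(2-4) by simp

lemma env_definable_bex:
  assumes "definable1 S" "env_definable (\<lambda>e. Q (\<lambda>i. e (Suc i)) (e 0))"
  shows "env_definable (\<lambda>e. \<exists>x\<in>S. Q e x)"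
  unfolding Bex_def by (intro env_definable_ex env_definable_conj env_definable_mem assms coordinateI)

lemma env_definable_ball:
  assumes "definable1 S" "env_definable (\<lambda>e. Q (\<lambda>i. e (Suc i)) (e 0))"
  shows "env_definable (\<lambda>e. \<forall>x\<in>S. Q e x)"
  unfolding Ball_def by (intro env_definable_all env_definable_imp env_definable_mem assms coordinateI)

lemmas env_definable_intros =
  env_definable_const env_definable_bex env_definable_ball env_definable_ex env_definable_all
  env_definable_conj env_definable_disj env_definable_imp env_definable_not
  env_definable_mem
  env_definable_eq env_definable_less_add env_definable_add_le env_definable_less env_definable_le
  coordinateI constantI

lemma Rpow_iff: "x \<in> Rpow k \<longleftrightarrow> (\<forall>i\<ge>k. x i = 0)"
  by (simp add: topspace_Euclidean_space)

text \<open>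
  A formula may refer to coordinates from \<open>k\<close> on. They vanish on \<open>\<real>\<^sup>k\<close>, hence become the
  parameter \<open>0\<close>.
\<close>
lemma definable_if_env_definable:
  assumes "env_definable Q"
  shows "definable M k {x \<in> Rpow k. Q x}"
proof -
  obtain \<phi> \<sigma> where \<phi>: "wf_formula M \<phi>" and \<sigma>: "\<And>i. coordinate_or_constant (\<sigma> i)"
    and Q: "\<And>e. Q e \<longleftrightarrow> sat M (\<lambda>i. \<sigma> i e) \<phi>"
    using assms by (rule env_definableE) (rule that)
  let ?r = "\<lambda>i. if \<exists>j<k. \<sigma> i = (\<lambda>e. e j) then SOME j. j < k \<and> \<sigma> i = (\<lambda>e. e j) else k + i"
  let ?p = "\<lambda>i. \<sigma> i (\<lambda>j. 0)"
  have key: "tuple_append k x ?p (?r i) = \<sigma> i x" if x: "x \<in> Rpow k" for x i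
  proof (cases "\<exists>j<k. \<sigma> i = (\<lambda>e. e j)")
    case True
    define j where "j = (SOME j. j < k \<and> \<sigma> i = (\<lambda>e. e j))"
    have r: "?r i = j" unfolding j_def using True by (rule if_P)
    have j: "j < k \<and> \<sigma> i = (\<lambda>e. e j)"
      unfolding j_def using True by (rule someI_ex[of "\<lambda>j. j < k \<and> \<sigma> i = (\<lambda>e. e j)"])
    then have "tuple_append k x ?p j = \<sigma> i x" by (simp add: tuple_append_def)
    then show ?thesis unfolding r .
  next
    case False
    then have "\<sigma> i x = \<sigma> i (\<lambda>j. 0)"
      using \<sigma>[of i] x unfolding coordinate_or_constant_def Rpow_iff by (auto simp: not_less)
    then show ?thesis using False by (auto simp: tuple_append_def)
  qed
  have "sat M (tuple_append k x ?p) (rename ?r \<phi>) \<longleftrightarrow> Q x" if "x \<in> Rpow k" for x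
    unfolding sat_rename key[OF that] Q ..
  then have "{x \<in> Rpow k. Q x} = {x \<in> Rpow k. sat M (tuple_append k x ?p) (rename ?r \<phi>)}"
    by (intro Collect_cong conj_cong refl) (rule sym)
  with wf_rename[OF \<phi>, of ?r] show ?thesis
    unfolding definable_def by (intro exI[of _ "rename ?r \<phi>"] exI[of _ ?p] conjI)
qed

lemma env_definable_if_definable:
  assumes "definable M k X" "\<And>i. coordinate_or_constant (\<tau> i)" "\<And>e. (\<lambda>i. \<tau> i e) \<in> Rpow k"
  shows "env_definable (\<lambda>e. (\<lambda>i. \<tau> i e) \<in> X)"
proof -
  obtain \<phi> p where \<phi>: "wf_formula M \<phi>" and X: "X = {x \<in> Rpow k. sat M (tuple_append k x p) \<phi>}"
    using assms(1) unfolding definable_def by blast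
  show ?thesis
  proof (rule env_definableI[OF \<phi>, of "\<lambda>i e. tuple_append k (\<lambda>i. \<tau> i e) p i"])
    show "coordinate_or_constant (\<lambda>e. tuple_append k (\<lambda>i. \<tau> i e) p i)" for i
      using assms(2) by (cases "i < k") (auto simp: tuple_append_def)
  qed (use assms(3) in \<open>auto simp: X\<close>)
qed

definition truncate :: "nat \<Rightarrow> (nat \<Rightarrow> real) \<Rightarrow> nat \<Rightarrow> real" where
  "truncate k e = (\<lambda>i. if i < k then e i else 0)"

text \<open>
  Quantification over a point of \<open>\<real>\<^sup>k\<close> consists of \<open>k\<close> real quantifiers: the point occupies the
  indices below \<open>k\<close> and the free variables are shifted by \<open>k\<close>.
\<close>
lemma env_definable_ex_tuple:
  assumes "env_definable (\<lambda>e. Q (\<lambda>i. e (i + k)) (truncate k e))"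
  shows "env_definable (\<lambda>e. \<exists>x\<in>Rpow k. Q e x)"
  using assms
proof (induction k arbitrary: Q)
  case 0
  have [simp]: "truncate 0 e = (\<lambda>i. 0)" for e by (simp add: truncate_def)
  have "Rpow 0 = {\<lambda>i. 0}" by (auto simp: topspace_Euclidean_space)
  then show ?case using 0 by simp
next
  case (Suc k)
  let ?Q = "\<lambda>e x. \<exists>y. Q e (x(k := y))"
  have "(\<exists>x\<in>Rpow (Suc k). Q e x) \<longleftrightarrow> (\<exists>x\<in>Rpow k. ?Q e x)" for e
  proof
    assume "\<exists>x\<in>Rpow (Suc k). Q e x"
    then obtain x where x: "x \<in> Rpow (Suc k)" "Q e x" by blast
    have "x(k := 0) \<in> Rpow k" using x(1) unfolding Rpow_iff
      by (metis Suc_leI fun_upd_apply le_neq_implies_less)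
    moreover have "(x(k := 0))(k := x k) = x" by simp
    ultimately show "\<exists>x\<in>Rpow k. ?Q e x" using x(2) by metis
  next
    assume "\<exists>x\<in>Rpow k. ?Q e x"
    then obtain x y where "x \<in> Rpow k" "Q e (x(k := y))" by blast
    moreover have "x(k := y) \<in> Rpow (Suc k)" using \<open>x \<in> Rpow k\<close> unfolding Rpow_iff by auto
    ultimately show "\<exists>x\<in>Rpow (Suc k). Q e x" by blast
  qed
  moreover have "env_definable (\<lambda>e. \<exists>x\<in>Rpow k. ?Q e x)"
  proof (rule Suc.IH, rule env_definable_ex)
    let ?\<tau> = "\<lambda>i e. if i < k then e (Suc i) else if i = k then e 0 else e i"
    have "env_definable (\<lambda>e. Q (\<lambda>i. ?\<tau> (i + Suc k) e) (truncate (Suc k) (\<lambda>i. ?\<tau> i e)))"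
    proof (rule env_definable_subst[OF Suc.prems, of ?\<tau>])
      show "coordinate_or_constant (?\<tau> i)" for i
        by (cases "i < k"; cases "i = k") auto
    qed
    moreover have "truncate (Suc k) (\<lambda>i. ?\<tau> i e) = (truncate k (\<lambda>i. e (Suc i)))(k := e 0)" for e
      by (auto simp: truncate_def)
    ultimately show "env_definable (\<lambda>e. Q (\<lambda>i. e (Suc (i + k))) ((truncate k (\<lambda>i. e (Suc i)))(k := e 0)))"
      by simp
  qed
  ultimately show ?case by simp
qed

end

section \<open>A sparse sequence of best approximations\<close>

text \<open>
  The relation \<open>le\<close> says that a point of \<open>S\<close> appears no later than another one.  It is unrelated to
  the order of the reals.  Distinct points may appear simultaneously.
\<close>
locale dense_finitary_preorder =
  fixes S :: "real set" and le :: "real \<Rightarrow> real \<Rightarrow> bool" and a b :: real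
  assumes le_total: "\<lbrakk>x \<in> S; y \<in> S\<rbrakk> \<Longrightarrow> le x y \<or> le y x"
    and le_trans: "\<lbrakk>x \<in> S; y \<in> S; z \<in> S; le x y; le y z\<rbrakk> \<Longrightarrow> le x z"
    and finite_below: "y \<in> S \<Longrightarrow> finite {x \<in> S. le x y}"
    and a_less_b: "a < b"
    and S_bounds: "S \<subseteq> {a<..<b}"
    and dense: "\<lbrakk>a \<le> x; x < y; y \<le> b\<rbrakk> \<Longrightarrow> \<exists>z\<in>S. x < z \<and> z < y"
begin

definition below :: "real \<Rightarrow> real set" where
  "below x = {y \<in> S. le y x}"

text \<open>
  Behind each point that has appeared by the time of \<open>n\<close>, and before the next such point on the real
  line, at least two points appear by the time of \<open>n'\<close>. These two are what makes room for one free
  binary digit.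
\<close>
definition separated_in :: "real \<Rightarrow> real \<Rightarrow> bool" where
  "separated_in n n' \<longleftrightarrow>
     (\<forall>u\<in>below n. \<exists>m\<in>below n'. \<exists>m'\<in>below n'. u < m \<and> m < m' \<and> (\<forall>e\<in>below n. u < e \<longrightarrow> m' < e))"

lemma finite_below': "x \<in> S \<Longrightarrow> finite (below x)"
  unfolding below_def by (rule finite_below)

lemma self_below: "x \<in> S \<Longrightarrow> x \<in> below x"
  using le_total unfolding below_def by blast

lemma not_le_imp_le: "\<lbrakk>x \<in> S; y \<in> S; \<not> le x y\<rbrakk> \<Longrightarrow> le y x"
  using le_total by blast

lemma below_mono: "\<lbrakk>x \<in> S; y \<in> S; le x y\<rbrakk> \<Longrightarrow> below x \<subseteq> below y"
  unfolding below_def using le_trans by blast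

lemma least_exists: "\<lbrakk>finite F; F \<noteq> {}; F \<subseteq> S\<rbrakk> \<Longrightarrow> \<exists>m\<in>F. \<forall>e\<in>F. le m e"
proof (induction F rule: finite_induct)
  case (insert y F)
  show ?case
  proof (cases "F = {}")
    case True
    then show ?thesis using insert.prems le_total by blast
  next
    case False
    then obtain m where m: "m \<in> F" "\<forall>e\<in>F. le m e" using insert by blast
    show ?thesis
    proof (cases "le m y")
      case True
      then show ?thesis using m by blast
    next
      case False
      then have "le y m" using not_le_imp_le m(1) insert.prems by blast
      then have "\<forall>e\<in>F. le y e" using m le_trans insert.prems by (meson insertCI subsetD)
      moreover have "le y y" using le_total insert.prems by blast
      ultimately show ?thesis by blast
    qed
  qed
qed simp

lemma avoid_finite:
  fixes F :: "real set"
  assumes "finite F" "l < r"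
  obtains r' where "l < r'" "r' < r" "F \<inter> {l<..<r'} = {}"
proof -
  let ?G = "insert r (F \<inter> {l<..})"
  have G: "finite ?G" "?G \<noteq> {}" using assms(1) by auto
  have lM: "l < Min ?G" using G assms(2) by (subst Min_gr_iff) auto
  have Mr: "Min ?G \<le> r" using G by (intro Min_le) auto
  have "F \<inter> {l<..<(l + Min ?G) / 2} = {}"
  proof -
    have "Min ?G \<le> x" if "x \<in> F" "l < x" for x using that G by (intro Min_le) auto
    then show ?thesis using lM by fastforce
  qed
  with lM Mr show ?thesis by (intro that[of "(l + Min ?G) / 2"]) auto
qed

text \<open>
  The interval behind each of the finitely many points contains infinitely many points of \<open>S\<close>, of
  which two are picked.
\<close>
lemma separating_witnesses:
  assumes "n \<in> S"
  obtains W where "finite W" "W \<subseteq> S"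
    "\<And>u. u \<in> below n \<Longrightarrow> \<exists>m\<in>W. \<exists>m'\<in>W. u < m \<and> m < m' \<and> (\<forall>e\<in>below n. u < e \<longrightarrow> m' < e)"
proof -
  have "\<exists>m m'. m \<in> S \<and> m' \<in> S \<and> u < m \<and> m < m' \<and> (\<forall>e\<in>below n. u < e \<longrightarrow> m' < e)"
    if u: "u \<in> below n" for u
  proof -
    have "a < u" "u < b" using u S_bounds unfolding below_def by auto
    then obtain r where r: "u < r" "r < b" "below n \<inter> {u<..<r} = {}"
      using avoid_finite[OF finite_below'[OF assms]] by blast
    obtain m where m: "m \<in> S" "u < m" "m < r" using dense[of u r] r \<open>a < u\<close> by auto
    obtain m' where m': "m' \<in> S" "m < m'" "m' < r" using dense[of m r] r m \<open>a < u\<close> by auto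
    have "m' < e" if "e \<in> below n" "u < e" for e
      using that r(3) m'(3) by force
    then show ?thesis using m m' by blast
  qed
  then obtain m m' where mm: "\<And>u. u \<in> below n \<Longrightarrow> m u \<in> S \<and> m' u \<in> S \<and> u < m u \<and> m u < m' u
      \<and> (\<forall>e\<in>below n. u < e \<longrightarrow> m' u < e)"
    by metis
  show ?thesis
  proof (rule that[of "m ` below n \<union> m' ` below n"])
    show "finite (m ` below n \<union> m' ` below n)" using finite_below'[OF assms] by simp
  qed (use mm in auto)
qed

text \<open>
  Shrinking the interval \<open>(l, r)\<close> towards its left end \<open>l\<close> removes any finite number of points of
  \<open>S\<close>. Hence the first points that appear in the smaller interval appear as late as desired. One of
  them is \<open>l'\<close>, and \<open>r'\<close> is so close to it that no point between \<open>l'\<close> and \<open>r'\<close> appears before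
  \<open>l'\<close> or together with it.
\<close>
lemma next_approximation:
  assumes "l \<in> S" "l < r" "r \<le> b"
  obtains l' r' where "l' \<in> S" "l < l'" "l' < r'" "r' \<le> r"
    "le l l'" "\<not> le l' l" "separated_in l l'"
    "\<And>e. \<lbrakk>e \<in> S; l < e; e < r'\<rbrakk> \<Longrightarrow> le l' e"
    "\<And>e. \<lbrakk>e \<in> S; l' < e; e < r'\<rbrakk> \<Longrightarrow> \<not> le e l'"
proof -
  obtain W where W: "finite W" "W \<subseteq> S"
    "\<And>u. u \<in> below l \<Longrightarrow> \<exists>m\<in>W. \<exists>m'\<in>W. u < m \<and> m < m' \<and> (\<forall>e\<in>below l. u < e \<longrightarrow> m' < e)"
    using separating_witnesses[OF assms(1)] by metis
  \<comment> \<open>The new point must come strictly later than \<open>l\<close> and all witnesses of separation.\<close>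
  let ?bad = "\<Union>w\<in>insert l W. below w"
  have "finite ?bad" using W assms(1) finite_below' by auto
  then obtain q where q: "l < q" "q < r" "?bad \<inter> {l<..<q} = {}"
    using avoid_finite assms(2) by blast
  have "a < l" using assms(1) S_bounds by auto
  then obtain x where x: "x \<in> S" "l < x" "x < q" using dense[of l q] q assms(3) by auto
  let ?C = "below x \<inter> {l<..<q}"
  have C: "finite ?C" "x \<in> ?C" using x finite_below' self_below by auto
  then have "\<exists>l'\<in>?C. \<forall>e\<in>?C. le l' e"
    by (intro least_exists) (auto simp: below_def)
  then obtain l' where l': "l' \<in> ?C" "\<And>e. e \<in> ?C \<Longrightarrow> le l' e" by blast
  have l'S: "l' \<in> S" "l < l'" "l' < q" using l'(1) unfolding below_def by auto
  obtain r' where r': "l' < r'" "r' < q" "below l' \<inter> {l'<..<r'} = {}"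
    using avoid_finite[OF finite_below'[OF l'S(1)] l'S(3)] by blast
  have above: "le w l' \<and> \<not> le l' w" if "w \<in> insert l W" for w
  proof -
    have "w \<in> S" using that W(2) assms(1) by auto
    moreover have "l' \<notin> below w" using q(3) l'S that by auto
    ultimately show ?thesis using not_le_imp_le l'S(1) unfolding below_def by blast
  qed
  have W_below: "W \<subseteq> below l'" using above W(2) unfolding below_def by auto
  show ?thesis
  proof (rule that[of l' r'])
    show "separated_in l l'"
      unfolding separated_in_def
    proof
      fix u assume "u \<in> below l"
      from W(3)[OF this] show "\<exists>m\<in>below l'. \<exists>m'\<in>below l'. u < m \<and> m < m' \<and> (\<forall>e\<in>below l. u < e \<longrightarrow> m' < e)"
        using W_below by blast
    qed
    show "le l' e" if "e \<in> S" "l < e" "e < r'" for e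
    proof (rule ccontr)
      assume "\<not> le l' e"
      then have "le e x"
        using not_le_imp_le le_trans l'(1) that(1) x(1) l'S(1) unfolding below_def by blast
      then have "e \<in> ?C" using that r'(2) unfolding below_def by auto
      with l'(2) \<open>\<not> le l' e\<close> show False by blast
    qed
    show "\<not> le e l'" if "e \<in> S" "l' < e" "e < r'" for e
      using r'(3) that unfolding below_def by auto
  qed (use l'S r' q above in auto)
qed

text \<open>
  The best approximations of \<open>c0\<close> from below, starting with \<open>l0\<close>.  They increase both on the real
  line and in order of appearance, so that the successor of a member is definable from the order
  of the reals.
\<close>
definition scale :: "real \<Rightarrow> real \<Rightarrow> real set" where
  "scale l0 c0 = {d \<in> S. l0 \<le> d \<and> d < c0 \<and> (\<forall>e\<in>S. d < e \<and> e < c0 \<longrightarrow> \<not> le e d)}"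

text \<open>
  The intervals \<open>(l i, r i)\<close> of \<open>next_approximation\<close> are nested, and \<open>c0\<close> is the limit of their
  left ends. It satisfies \<open>l i < c0 \<le> r i\<close>. So \<open>l i\<close> is a best approximation since nothing early enough
  lies in \<open>(l i, r i)\<close>.  Conversely, a point strictly between \<open>l i\<close> and \<open>l (i + 1)\<close> is no best
  approximation, because \<open>l (i + 1)\<close> is closer to \<open>c0\<close> and is among the first to appear
  in \<open>(l i, c0)\<close>.
\<close>
lemma sparse_scale:
  obtains l :: "nat \<Rightarrow> real" and c0 where
    "strict_mono l" "range l = scale (l 0) c0" "\<And>i. l i \<in> S"
    "\<And>i. below (l i) \<subseteq> below (l (Suc i))" "\<And>i. separated_in (l i) (l (Suc i))"
    "\<And>x. x \<in> S \<Longrightarrow> \<exists>i. x \<in> below (l i)"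
proof -
  \<comment> \<open>The pairs \<open>p = (l i, r i)\<close> satisfy \<open>?P\<close>, and consecutive ones are related by \<open>?Q\<close>.\<close>
  let ?P = "\<lambda>p. fst p \<in> S \<and> fst p < snd p \<and> snd p \<le> b \<and>
      (\<forall>e\<in>S. fst p < e \<and> e < snd p \<longrightarrow> \<not> le e (fst p))"
  let ?Q = "\<lambda>p q. fst p < fst q \<and> snd q \<le> snd p \<and> le (fst p) (fst q) \<and> \<not> le (fst q) (fst p) \<and>
      separated_in (fst p) (fst q) \<and> (\<forall>e\<in>S. fst p < e \<and> e < snd q \<longrightarrow> le (fst q) e)"
  have "\<exists>g. \<forall>n::nat. ?P (g n) \<and> ?Q (g n) (g (Suc n))"
  proof (rule dependent_nat_choice)
    obtain l where l: "l \<in> S" using dense[of a b] a_less_b by auto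
    then have "l < b" using S_bounds by auto
    then obtain r where "l < r" "r < b" "below l \<inter> {l<..<r} = {}"
      using avoid_finite[OF finite_below'[OF l]] by blast
    then show "\<exists>p. ?P p" using l by (intro exI[of _ "(l, r)"]) (auto simp: below_def)
  next
    fix p and n :: nat
    assume p: "?P p"
    obtain l' r' where "l' \<in> S" "fst p < l'" "l' < r'" "r' \<le> snd p"
      "le (fst p) l'" "\<not> le l' (fst p)" "separated_in (fst p) l'"
      "\<And>e. \<lbrakk>e \<in> S; fst p < e; e < r'\<rbrakk> \<Longrightarrow> le l' e"
      "\<And>e. \<lbrakk>e \<in> S; l' < e; e < r'\<rbrakk> \<Longrightarrow> \<not> le e l'"
      using next_approximation[of "fst p" "snd p"] p by blast
    then show "\<exists>q. ?P q \<and> ?Q p q" using p by (intro exI[of _ "(l', r')"]) auto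
  qed
  then obtain g where g: "\<And>n::nat. ?P (g n) \<and> ?Q (g n) (g (Suc n))" by blast
  define l where "l n = fst (g n)" for n
  define r where "r n = snd (g n)" for n
  have lS: "l n \<in> S" and lr: "l n < r n" and rb: "r n \<le> b"
    and lmax: "\<And>e. \<lbrakk>e \<in> S; l n < e; e < r n\<rbrakk> \<Longrightarrow> \<not> le e (l n)"
    and ll: "l n < l (Suc n)" and rr: "r (Suc n) \<le> r n" and le: "le (l n) (l (Suc n))"
    and nle: "\<not> le (l (Suc n)) (l n)" and sep: "separated_in (l n) (l (Suc n))"
    and first: "\<And>e. \<lbrakk>e \<in> S; l n < e; e < r (Suc n)\<rbrakk> \<Longrightarrow> le (l (Suc n)) e" for n
    using g[of n] unfolding l_def r_def by auto
  have mono: "strict_mono l" using ll by (simp add: strict_mono_Suc_iff)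
  have anti: "antimono r" using rr by (simp add: antimono_iff_le_Suc)
  have lr': "l m < r n" for m n
  proof -
    have "l m \<le> l (max m n)" using mono by (simp add: strict_mono_less_eq)
    also have "\<dots> < r (max m n)" by (rule lr)
    also have "\<dots> \<le> r n" using anti by (simp add: antimonoD)
    finally show ?thesis .
  qed
  define c0 where "c0 = (SUP n. l n)"
  have bdd: "bdd_above (range l)" using lr'[of _ 0] by (intro bdd_aboveI[of _ "r 0"]) (auto intro: less_imp_le)
  have lc: "l n < c0" for n
    unfolding c0_def using ll[of n] cSUP_upper[OF _ bdd, of "Suc n"] by simp
  have cr: "c0 \<le> r n" for n
    unfolding c0_def using lr' by (intro cSUP_least) (auto intro: less_imp_le)
  have below_Suc: "below (l i) \<subseteq> below (l (Suc i))" for i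
    using below_mono lS le by blast
  have "range l = scale (l 0) c0"
  proof (intro equalityI subsetI)
    fix d assume "d \<in> range l"
    then obtain i where d: "d = l i" by blast
    have "l 0 \<le> l i" using mono by (simp add: strict_mono_less_eq)
    then show "d \<in> scale (l 0) c0"
      unfolding scale_def d using lS[of i] lc[of i] lmax[of _ i] cr[of i] by force
  next
    fix d assume "d \<in> scale (l 0) c0"
    then have d: "d \<in> S" "l 0 \<le> d" "d < c0" "\<And>e. \<lbrakk>e \<in> S; d < e; e < c0\<rbrakk> \<Longrightarrow> \<not> le e d"
      unfolding scale_def by auto
    obtain k where "d < l k"
      using d(3) bdd unfolding c0_def by (subst (asm) less_cSUP_iff) auto
    then have k: "d < l (LEAST k. d < l k)" (is "d < l ?k") by (rule LeastI)
    show "d \<in> range l"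
    proof (cases ?k)
      case 0
      then show ?thesis using k d(2) by simp
    next
      case (Suc i)
      then have "\<not> d < l i" using not_less_Least[of i "\<lambda>k. d < l k"] by simp
      show ?thesis
      proof (cases "d = l i")
        case False
        then have "l i < d" using \<open>\<not> d < l i\<close> by simp
        have "le (l ?k) d"
          using first[OF d(1) \<open>l i < d\<close>] d(3) cr[of "Suc i"] Suc by simp
        then show ?thesis using d(4)[OF lS k lc] by blast
      qed simp
    qed
  qed
  moreover have "\<exists>i. x \<in> below (l i)" if x: "x \<in> S" for x
  proof (rule ccontr)
    assume "\<nexists>i. x \<in> below (l i)"
    then have "range l \<subseteq> below x" using not_le_imp_le x lS unfolding below_def by blast
    then have "finite (range l)" using finite_below'[OF x] finite_subset by blast
    then show False using strict_mono_imp_inj_on[OF mono] finite_imageD by blast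
  qed
  ultimately show ?thesis using that mono lS below_Suc sep by blast
qed

end

section \<open>Coding subsets of the natural numbers by real numbers\<close>

locale sparse_sequence = dense_finitary_preorder +
  fixes l :: "nat \<Rightarrow> real"
  assumes l_in_S: "l i \<in> S"
    and below_Suc: "below (l i) \<subseteq> below (l (Suc i))"
    and separated: "separated_in (l i) (l (Suc i))"
    and exhaust: "x \<in> S \<Longrightarrow> \<exists>i. x \<in> below (l i)"
begin

text \<open>
  For a code \<open>c\<close>, let \<open>u\<close> be the largest point below \<open>c\<close> among those that have appeared by stage \<open>i\<close>. The set consists of the
  points between \<open>u\<close> and \<open>c\<close> that have appeared by stage \<open>i + 1\<close>; it is written without \<open>u\<close> in order
  to be visibly definable.
\<close>
definition fresh :: "nat \<Rightarrow> real \<Rightarrow> real set" where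
  "fresh i c = {m \<in> below (l (Suc i)). m < c \<and> (\<forall>e\<in>below (l i). e < c \<longrightarrow> e < m)}"

text \<open>
  A code passes one or two new points at each stage, and \<open>decode\<close> collects the stages at which it
  passes two.  The conditions on \<open>l 0\<close> fix the part of the first partition that contains the code,
  and the bound \<open>b\<close> excludes the numbers to the right of \<open>S\<close>, which no point of \<open>S\<close> tells apart.
\<close>
definition codes :: "real set" where
  "codes = {c. l 0 < c \<and> c \<le> b \<and> (\<forall>e\<in>below (l 0). e < c \<longrightarrow> e \<le> l 0) \<and>
               (\<forall>i. card (fresh i c) \<in> {1, 2})}"

definition decode :: "real \<Rightarrow> nat set" where
  "decode c = {i. card (fresh i c) = 2}"

lemma finite_fresh: "finite (fresh i c)"
  using finite_below'[OF l_in_S[of "Suc i"]] unfolding fresh_def by auto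

text \<open>
  Suppose that no point of stage \<open>i\<close> separates \<open>c\<close> and \<open>c'\<close>.  Then the new points passed by \<open>c\<close> are
  among those passed by \<open>c'\<close>.  The two finite sets are equally large, hence equal, so that no point of
  stage \<open>i + 1\<close> separates \<open>c\<close> and \<open>c'\<close> either.
\<close>
lemma same_decode_imp_same_cut:
  assumes "c \<in> codes" "c' \<in> codes" "c < c'" "decode c = decode c'"
  shows "{e \<in> below (l i). e < c} = {e \<in> below (l i). e < c'}"
proof (induction i)
  case 0
  have "l 0 < c" "\<And>e. \<lbrakk>e \<in> below (l 0); e < c'\<rbrakk> \<Longrightarrow> e \<le> l 0"
    using assms(1,2) unfolding codes_def by auto
  then show ?case using assms(3) by fastforce
next
  case (Suc i)
  have cut: "e < c" if "e \<in> below (l i)" "e < c'" for e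
    using Suc that by blast
  have sub: "fresh i c \<subseteq> fresh i c'"
    unfolding fresh_def using cut assms(3) by auto
  have "card (fresh i c) = card (fresh i c')"
  proof -
    have "card (fresh i c) = 2 \<longleftrightarrow> card (fresh i c') = 2"
      using assms(4) unfolding decode_def by blast
    moreover have "card (fresh i c) \<in> {1, 2}" "card (fresh i c') \<in> {1, 2}"
      using assms(1,2) unfolding codes_def by blast+
    ultimately show ?thesis by auto
  qed
  then have eq: "fresh i c = fresh i c'"
    using card_subset_eq[OF finite_fresh sub] by simp
  have "e < c" if e: "e \<in> below (l (Suc i))" "e < c'" for e
  proof (rule ccontr)
    assume "\<not> e < c"
    then have "e \<in> fresh i c'" unfolding fresh_def using e cut by fastforce
    then have "e \<in> fresh i c" unfolding eq .
    then show False using \<open>\<not> e < c\<close> unfolding fresh_def by simp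
  qed
  then show ?case using assms(3) by auto
qed

lemma inj_decode: "inj_on decode codes"
proof -
  have False if cc: "c \<in> codes" "c' \<in> codes" "c < c'" "decode c = decode c'" for c c'
  proof -
    have "l 0 < c" "c' \<le> b" using cc(1,2) unfolding codes_def by auto
    moreover have "a < l 0" using l_in_S[of 0] S_bounds by auto
    ultimately have "a \<le> c" "c' \<le> b" by auto
    then obtain z where z: "z \<in> S" "c < z" "z < c'" using dense[of c c'] cc(3) by blast
    then obtain i where "z \<in> below (l i)" using exhaust by blast
    with z(3) have "z \<in> {e \<in> below (l i). e < c'}" by blast
    then have "z < c" unfolding same_decode_imp_same_cut[OF cc, symmetric] by blast
    then show False using z(2) by simp
  qed
  then show ?thesis by (intro linorder_inj_onI') blast
qed

definition adjacent :: "nat \<Rightarrow> real \<Rightarrow> real \<Rightarrow> bool" where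
  "adjacent i u v \<longleftrightarrow> v \<in> below (l i) \<and> u < v \<and> (\<forall>e\<in>below (l i). u < e \<longrightarrow> v \<le> e)"

lemma adjacent_exists:
  assumes "w \<in> below (l i)" "u < w"
  obtains v where "adjacent i u v"
proof -
  let ?F = "{e \<in> below (l i). u < e}"
  have F: "finite ?F" "?F \<noteq> {}" using finite_below'[OF l_in_S] assms by auto
  then have "Min ?F \<in> ?F" by (rule Min_in)
  moreover have "\<forall>e\<in>below (l i). u < e \<longrightarrow> Min ?F \<le> e" using F by auto
  ultimately show ?thesis by (intro that[of "Min ?F"]) (auto simp: adjacent_def)
qed

lemma two_adjacent:
  assumes "u \<in> below (l i)"
  obtains v w where "adjacent (Suc i) u v" "adjacent (Suc i) v w"
    "\<And>e. \<lbrakk>e \<in> below (l i); u < e\<rbrakk> \<Longrightarrow> w < e"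
proof -
  obtain m m' where m: "m \<in> below (l (Suc i))" "m' \<in> below (l (Suc i))" "u < m" "m < m'"
    "\<forall>e\<in>below (l i). u < e \<longrightarrow> m' < e"
    using separated[of i] assms unfolding separated_in_def by blast
  obtain v where v: "adjacent (Suc i) u v" using adjacent_exists[OF m(1,3)] .
  then have "v < m'" using m unfolding adjacent_def by force
  then obtain w where w: "adjacent (Suc i) v w" using adjacent_exists[OF m(2)] by blast
  then have "w \<le> m'" using m(2) \<open>v < m'\<close> unfolding adjacent_def by blast
  then have "w < e" if "e \<in> below (l i)" "u < e" for e
    using m(5) that by (meson order_le_less_trans)
  with v w show ?thesis by (rule that)
qed

text \<open>
  From \<open>u i\<close> one moves on to the first or the second point of the next stage, as \<open>X\<close> prescribes.
  Separation ensures that no point of stage \<open>i\<close> beyond \<open>u i\<close> is reached.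
\<close>
lemma cut_sequence:
  obtains u where "u 0 = l 0" "\<And>i. u i \<in> below (l i)" "\<And>i. u i < u (Suc i)"
    "\<And>i e. \<lbrakk>e \<in> below (l i); u i < e\<rbrakk> \<Longrightarrow> u (Suc i) < e"
    "\<And>i. card {m \<in> below (l (Suc i)). u i < m \<and> m \<le> u (Suc i)} = (if i \<in> X then 2 else 1)"
proof -
  let ?Q = "\<lambda>i u u'. u < u' \<and> (\<forall>e\<in>below (l i). u < e \<longrightarrow> u' < e) \<and>
     card {m \<in> below (l (Suc i)). u < m \<and> m \<le> u'} = (if i \<in> X then 2 else 1)"
  have step: "\<exists>u'. u' \<in> below (l (Suc i)) \<and> ?Q i u u'" if u: "u \<in> below (l i)" for u i
  proof -
    obtain v w where vw: "adjacent (Suc i) u v" "adjacent (Suc i) v w"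
      and w: "\<And>e. \<lbrakk>e \<in> below (l i); u < e\<rbrakk> \<Longrightarrow> w < e"
      using two_adjacent[OF u] by metis
    have v: "v \<in> below (l (Suc i))" "u < v" "w \<in> below (l (Suc i))" "v < w"
      using vw unfolding adjacent_def by auto
    have "m = v" if "m \<in> below (l (Suc i))" "u < m" "m \<le> v" for m
      using vw(1) that unfolding adjacent_def by (simp add: order_antisym)
    then have one: "{m \<in> below (l (Suc i)). u < m \<and> m \<le> v} = {v}"
      using v by blast
    have "m = v \<or> m = w" if m: "m \<in> below (l (Suc i))" "u < m" "m \<le> w" for m
    proof (cases "v < m")
      case True
      then show ?thesis using vw(2) m unfolding adjacent_def by (simp add: order_antisym)
    next
      case False
      then show ?thesis using vw(1) m unfolding adjacent_def by (simp add: order_antisym)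
    qed
    then have "{m \<in> below (l (Suc i)). u < m \<and> m \<le> w} = {v, w}"
      using v by auto
    then have two: "card {m \<in> below (l (Suc i)). u < m \<and> m \<le> w} = 2" using v by simp
    show ?thesis
    proof (cases "i \<in> X")
      case True
      then show ?thesis using v w two by (intro exI[of _ w]) simp
    next
      case False
      have "v < e" if "e \<in> below (l i)" "u < e" for e
        using w[OF that] v(4) by simp
      then show ?thesis using False v one by (intro exI[of _ v]) simp
    qed
  qed
  have "\<exists>u. \<forall>i. (u i \<in> below (l i) \<and> (i = 0 \<longrightarrow> u i = l 0)) \<and> ?Q i (u i) (u (Suc i))"
    by (rule dependent_nat_choice) (use self_below[OF l_in_S] step in auto)
  then show ?thesis using that by blast
qed

text \<open>
  The code of \<open>X\<close> is the supremum of the sequence \<open>u\<close>.  A point of stage \<open>i\<close> beyond \<open>u i\<close> is never reached later,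
  so that \<open>u i\<close> is the largest point of stage \<open>i\<close> below the supremum.  That \<open>u\<close> increases at
  every stage keeps the supremum strictly above each \<open>u i\<close>.
\<close>
lemma surj_decode:
  obtains c where "c \<in> codes" "decode c = X"
proof -
  obtain u where u0: "u 0 = l 0" and u: "\<And>i. u i \<in> below (l i)" and u_less: "\<And>i. u i < u (Suc i)"
    and gap: "\<And>i e. \<lbrakk>e \<in> below (l i); u i < e\<rbrakk> \<Longrightarrow> u (Suc i) < e"
    and card: "\<And>i. card {m \<in> below (l (Suc i)). u i < m \<and> m \<le> u (Suc i)} = (if i \<in> X then 2 else 1)"
    by (rule cut_sequence[of X]) (rule that)
  have uS: "u i \<in> S" for i using u unfolding below_def by auto
  have mono: "strict_mono u" using u_less by (simp add: strict_mono_Suc_iff)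
  define c where "c = (SUP i. u i)"
  have ub: "u i < b" for i using uS[of i] S_bounds by auto
  then have bdd: "bdd_above (range u)" by (intro bdd_aboveI[of _ b]) (auto intro: less_imp_le)
  have uc: "u i < c" for i
    unfolding c_def using u_less[of i] cSUP_upper[OF _ bdd, of "Suc i"] by simp
  have cb: "c \<le> b" unfolding c_def using ub by (intro cSUP_least) (auto intro: less_imp_le)
  have gap': "u j < e" if "e \<in> below (l i)" "u i < e" for i j e
  proof (cases "i \<le> j")
    case True
    then have "e \<in> below (l j) \<and> u j < e"
    proof (induction j rule: dec_induct)
      case (step j)
      then show ?case using gap below_Suc by blast
    qed (use that in simp)
    then show ?thesis by simp
  next
    case False
    then have "u j < u i" using mono by (simp add: strict_mono_less)
    then show ?thesis using that by simp
  qed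
  have cut: "e < c \<longleftrightarrow> e \<le> u i" if e: "e \<in> below (l i)" for e i
  proof
    assume "e < c"
    then obtain j where "e < u j" using bdd unfolding c_def by (subst (asm) less_cSUP_iff) auto
    then show "e \<le> u i" using gap'[OF e, of j] by force
  next
    assume "e \<le> u i"
    then show "e < c" using uc[of i] by simp
  qed
  have "m \<in> fresh i c \<longleftrightarrow> m \<in> below (l (Suc i)) \<and> u i < m \<and> m \<le> u (Suc i)" for i m
  proof -
    have "(\<forall>e\<in>below (l i). e < c \<longrightarrow> e < m) \<longleftrightarrow> u i < m"
      using cut[of _ i] u[of i] by (meson order.refl order.strict_trans1)
    then show ?thesis unfolding fresh_def using cut[of m "Suc i"] by auto
  qed
  then have "fresh i c = {m \<in> below (l (Suc i)). u i < m \<and> m \<le> u (Suc i)}" for i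
    by blast
  then have card_fresh: "card (fresh i c) = (if i \<in> X then 2 else 1)" for i
    using card by simp
  show ?thesis
  proof (rule that)
    show "c \<in> codes"
      unfolding codes_def using uc[of 0] cb cut[of _ 0] card_fresh by (auto simp: u0)
    show "decode c = X" unfolding decode_def using card_fresh by auto
  qed
qed

lemma bij_decode: "bij_betw decode codes UNIV"
proof -
  have "X \<in> decode ` codes" for X
    by (rule surj_decode[of X]) (auto intro: rev_image_eqI)
  then show ?thesis using inj_decode unfolding bij_betw_def by blast
qed

end

section \<open>Definability of the code\<close>

context ordered_group_expansion
begin

lemma real_point_0 [simp]: "real_point x 0 = x"
  by (simp add: real_point_def)

lemma real_point_in_Rpow: "real_point x \<in> Rpow 1"
  by (simp add: Rpow_iff real_point_def)

lemma real_point_eta: "x \<in> Rpow 1 \<Longrightarrow> real_point (x 0) = x"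
  by (auto simp: Rpow_iff real_point_def)

lemma definable_real_points:
  assumes "definable1 S"
  shows "definable M 1 (real_point ` S)"
proof -
  have "real_point ` S = {x \<in> Rpow 1. x 0 \<in> S}"
  proof (intro equalityI subsetI)
    fix x assume "x \<in> {x \<in> Rpow 1. x 0 \<in> S}"
    then show "x \<in> real_point ` S" using real_point_eta[of x] by force
  qed (use real_point_in_Rpow in auto)
  then show ?thesis
    using definable_if_env_definable[OF assms[unfolded definable1_def], of 1] by simp
qed

lemma definable_rel_real_points:
  assumes "definable2 R"
  shows "definable_rel M 1 1 ((\<lambda>(x, y). (real_point x, real_point y)) ` {(x, y). R x y})"
proof -
  let ?pair = "\<lambda>x y. tuple_append 1 (real_point x) (real_point y)"
  have pair: "?pair x y \<in> Rpow 2" "?pair x y 0 = x" "?pair x y 1 = y" for x y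
    by (auto simp: tuple_append_def Rpow_iff real_point_def)
  have eta: "?pair (z 0) (z 1) = z" if "z \<in> Rpow 2" for z
  proof
    fix i show "?pair (z 0) (z 1) i = z i"
      using that by (cases i; cases "i - 1") (auto simp: tuple_append_def Rpow_iff real_point_def)
  qed
  have "(\<lambda>(x, y). tuple_append 1 x y) ` (\<lambda>(x, y). (real_point x, real_point y)) ` {(x, y). R x y}
      = {z \<in> Rpow 2. R (z 0) (z 1)}" (is "?L = ?R")
  proof (intro equalityI subsetI)
    fix z assume "z \<in> ?L"
    then obtain x y where "z = ?pair x y" "R x y" by auto
    then show "z \<in> ?R" using pair[of x y] by simp
  next
    fix z assume "z \<in> ?R"
    then have "z = ?pair (z 0) (z 1)" "R (z 0) (z 1)" using eta[of z] by auto
    then show "z \<in> ?L" by (auto simp: image_image intro!: image_eqI[of _ _ "(z 0, z 1)"])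
  qed
  moreover have "definable M 2 {z \<in> Rpow 2. R (z 0) (z 1)}"
    by (rule definable_if_env_definable) (rule assms[unfolded definable2_def])
  moreover have "(\<lambda>(x, y). (real_point x, real_point y)) ` {(x, y). R x y} \<subseteq> Rpow 1 \<times> Rpow 1"
    by (auto intro: real_point_in_Rpow simp del: One_nat_def)
  ultimately show ?thesis
    unfolding definable_rel_def by (simp only: one_add_one)
qed

text \<open>
  Both sorts can be taken to be sets of real numbers, since codes are unique: no quotient has
  to be represented.
\<close>
lemma defines_B_from_coding:
  fixes l :: "nat \<Rightarrow> real" and P :: "real set"
  assumes "inj l" and "definable1 (range l)" and "definable1 P" and "definable2 E"
    and "definable2 (\<lambda>x y. \<exists>i. x = l i \<and> y = l (Suc i))"
    and "bij_betw dec P UNIV"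
    and "\<And>c i. c \<in> P \<Longrightarrow> E (l i) c \<longleftrightarrow> i \<in> dec c"
  shows "defines_B M"
proof -
  let ?N = "real_point ` range l"
  let ?P = "real_point ` P"
  let ?E = "\<lambda>x c. x \<in> range l \<and> c \<in> P \<and> E x c"
  let ?EE = "(\<lambda>(x, y). (real_point x, real_point y)) ` {(x, y). ?E x y}"
  define h where "h x = inv l (x 0)" for x :: "nat \<Rightarrow> real"
  define s where "s x = real_point (l (Suc (h x)))" for x
  have h [simp]: "h (real_point (l i)) = i" for i
    unfolding h_def using assms(1) by simp
  have s [simp]: "s (real_point (l i)) = real_point (l (Suc i))" for i
    unfolding s_def by simp
  have point_eq [simp]: "real_point x = real_point y \<longleftrightarrow> x = y" for x y
  proof
    assume "real_point x = real_point y"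
    then have "real_point x 0 = real_point y 0" by (rule fun_cong)
    then show "x = y" by simp
  qed simp
  have "definable2 ?E"
    unfolding definable2_def by (intro env_definable_intros env_definable_rel2[OF assms(4)] assms)
  then have E: "definable_rel M 1 1 ?EE"
    by (rule definable_rel_real_points)
  have "(\<lambda>x. (x, s x)) ` ?N = (\<lambda>(x, y). (real_point x, real_point y)) ` {(x, y). \<exists>i. x = l i \<and> y = l (Suc i)}"
    by (auto simp: image_iff)
  then have S: "definable_map M 1 1 ?N s"
    unfolding definable_map_def using definable_rel_real_points[OF assms(5)] by simp
  have "mso_iso \<lparr>psort = ?P, nsort = ?N, memrel = ?EE, nsucc = s\<rparr> structB"
    unfolding mso_iso_def structB_def mso_struct.simps
  proof (intro exI conjI)
    have "bij_betw (\<lambda>x. x 0) ?P P"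
      by (rule bij_betw_byWitness[where f' = real_point]) auto
    from bij_betw_trans[OF this assms(6)] show "bij_betw (dec \<circ> (\<lambda>x. x 0)) ?P UNIV" .
    show "bij_betw h ?N UNIV"
      by (rule bij_betw_byWitness[where f' = "\<lambda>i. real_point (l i)"]) auto
    show "\<forall>x\<in>?N. \<forall>X\<in>?P. (x, X) \<in> ?EE \<longleftrightarrow> (h x, (dec \<circ> (\<lambda>x. x 0)) X) \<in> {(x, X). x \<in> X}"
    proof (intro ballI)
      fix x X assume "x \<in> ?N" "X \<in> ?P"
      then obtain i c where x: "x = real_point (l i)" and X: "X = real_point c" and c: "c \<in> P"
        by blast
      have "(x, X) \<in> ?EE \<longleftrightarrow> E (l i) c"
        unfolding x X using c by auto
      then show "(x, X) \<in> ?EE \<longleftrightarrow> (h x, (dec \<circ> (\<lambda>x. x 0)) X) \<in> {(x, X). x \<in> X}"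
        using assms(7)[OF c, of i] unfolding x X by simp
    qed
    show "\<forall>x\<in>?N. h (s x) = Suc (h x)" by auto
  qed
  moreover have "?EE \<subseteq> ?N \<times> ?P" "s ` ?N \<subseteq> ?N" by auto
  ultimately show ?thesis
    unfolding defines_B_def
    using definable_real_points[OF assms(2)] definable_real_points[OF assms(3)] E S by blast
qed

text \<open>
  The right-hand side is a first-order condition, to be applied to the new points of a stage.
\<close>
lemma card_one_or_two_iff:
  fixes F :: "real set"
  assumes "finite F"
  shows "card F \<in> {1, 2} \<longleftrightarrow>
    (\<exists>m. m \<in> F) \<and> \<not> (\<exists>m m' m''. m \<in> F \<and> m' \<in> F \<and> m'' \<in> F \<and> m < m' \<and> m' < m'')"
    (is "_ \<longleftrightarrow> ?R")
proof
  assume "card F \<in> {1, 2}"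
  then have "card F = 1 \<or> card F = 2" by simp
  then obtain x y where F: "F = {x, y}"
  proof
    assume "card F = 1"
    then obtain x where "F = {x, x}" by (auto simp: card_1_singleton_iff)
    then show ?thesis by (rule that)
  next
    assume "card F = 2"
    then show ?thesis by (auto simp: card_2_iff intro: that)
  qed
  show ?R unfolding F by auto
next
  assume R: ?R
  then have "card F \<noteq> 0" using assms by auto
  moreover have "\<not> 3 \<le> card F"
  proof
    assume "3 \<le> card F"
    then obtain T where "T \<subseteq> F" "card T = 3" by (rule obtain_subset_with_card_n)
    then obtain x y z where xyz: "{x, y, z} \<subseteq> F" "x \<noteq> y" "y \<noteq> z" "x \<noteq> z"
      unfolding card_3_iff by blast
    have "\<not> (u < v \<and> v < w)" if "u \<in> {x, y, z}" "v \<in> {x, y, z}" "w \<in> {x, y, z}" for u v w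
      using R that xyz(1) by blast
    then show False
      using xyz(2-4) by (metis insertCI linorder_neqE)
  qed
  ultimately show "card F \<in> {1, 2}" by auto
qed

lemma card_two_iff:
  fixes F :: "real set"
  assumes "card F \<in> {1, 2}"
  shows "card F = 2 \<longleftrightarrow> (\<exists>m m'. m \<in> F \<and> m' \<in> F \<and> m < m')"
proof
  assume "card F = 2"
  then obtain x y where "F = {x, y}" "x \<noteq> y" unfolding card_2_iff by blast
  then show "\<exists>m m'. m \<in> F \<and> m' \<in> F \<and> m < m'" by (cases x y rule: linorder_cases) auto
next
  assume "\<exists>m m'. m \<in> F \<and> m' \<in> F \<and> m < m'"
  then have "card F \<noteq> 1" by (auto simp: card_1_singleton_iff)
  then show "card F = 2" using assms by auto
qed

text \<open>
  The stages are the points of \<open>range l\<close>, a definable set by \<open>sparse_scale\<close>. Since \<open>l\<close> is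
  strictly monotone, its successor relation is the one given by the order of the reals, and with it
  \<open>codes\<close> and the digits of a code become first-order conditions.
\<close>
lemma defines_B_if_dense_finitary_preorder:
  assumes "definable1 S" "definable2 le" "dense_finitary_preorder S le a b"
  shows "defines_B M"
proof -
  interpret dense_finitary_preorder S le a b by (rule assms(3))
  obtain l :: "nat \<Rightarrow> real" and c0 where mono: "strict_mono l" and N: "range l = scale (l 0) c0"
    and l: "\<And>i. l i \<in> S" "\<And>i. below (l i) \<subseteq> below (l (Suc i))"
      "\<And>i. separated_in (l i) (l (Suc i))" "\<And>x. x \<in> S \<Longrightarrow> \<exists>i. x \<in> below (l i)"
    by (rule sparse_scale) (rule that)
  interpret sparse_sequence S le a b l
    by unfold_locales (rule l)+
  note le_def' = env_definable_rel2[OF assms(2)]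
  define l0 where "l0 = l 0"
  have N': "definable1 (range l)"
    unfolding N l0_def[symmetric] scale_def definable1_def mem_Collect_eq
    by (intro env_definable_intros le_def' assms(1))
  define succ where "succ x y \<longleftrightarrow> x \<in> range l \<and> y \<in> range l \<and> x < y \<and> \<not> (\<exists>z\<in>range l. x < z \<and> z < y)"
    for x y
  have succ: "succ (l i) y \<longleftrightarrow> y = l (Suc i)" for i y
  proof
    assume "succ (l i) y"
    then obtain j where "y = l j" "l i < l j" "\<not> (l i < l (Suc i) \<and> l (Suc i) < l j)"
      unfolding succ_def by blast
    then have "j = Suc i" using mono by (simp add: strict_mono_less)
    then show "y = l (Suc i)" using \<open>y = l j\<close> by simp
  next
    assume "y = l (Suc i)"
    then show "succ (l i) y" unfolding succ_def using mono by (auto simp: strict_mono_less)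
  qed
  have "succ x y \<Longrightarrow> x \<in> range l" for x y unfolding succ_def by simp
  then have succ_eq: "succ x y \<longleftrightarrow> (\<exists>i. x = l i \<and> y = l (Suc i))" for x y
    using succ by blast
  have succ2: "definable2 succ"
    unfolding definable2_def succ_def by (intro env_definable_intros N')
  note succ_def' = env_definable_rel2[OF this]
  define new where "new n n' c m \<longleftrightarrow> m \<in> S \<and> le m n' \<and> m < c \<and>
      (\<forall>e\<in>S. le e n \<and> e < c \<longrightarrow> e < m)" for n n' c m
  have new: "new (l i) (l (Suc i)) c m \<longleftrightarrow> m \<in> fresh i c" for i c m
    unfolding new_def fresh_def below_def by auto
  have new_def': "env_definable (\<lambda>e. new (n e) (n' e) (c e) (m e))"
    if "coordinate_or_constant n" "coordinate_or_constant n'" "coordinate_or_constant c"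
      "coordinate_or_constant m" for n n' c m
  proof -
    have "env_definable (\<lambda>e. new (e 0) (e 1) (e 2) (e 3))"
      unfolding new_def by (intro env_definable_intros le_def' assms(1))
    from env_definable_subst[OF this,
        of "\<lambda>i. if i = 0 then n else if i = 1 then n' else if i = 2 then c else m"]
    show ?thesis using that by simp
  qed
  define good where "good n n' c \<longleftrightarrow> (\<exists>m. new n n' c m) \<and>
      \<not> (\<exists>m m' m''. new n n' c m \<and> new n n' c m' \<and> new n n' c m'' \<and> m < m' \<and> m' < m'')" for n n' c
  have good: "good (l i) (l (Suc i)) c \<longleftrightarrow> card (fresh i c) \<in> {1, 2}" for i c
    unfolding good_def new card_one_or_two_iff[OF finite_fresh] ..
  have all_good: "(\<forall>n n'. succ n n' \<longrightarrow> good n n' c) \<longleftrightarrow> (\<forall>i. card (fresh i c) \<in> {1, 2})" for c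
    unfolding succ_eq good[symmetric] by blast
  have codes_eq: "codes = {c. l0 < c \<and> c \<le> b \<and> (\<forall>e\<in>S. le e l0 \<and> e < c \<longrightarrow> e \<le> l0) \<and>
      (\<forall>n n'. succ n n' \<longrightarrow> good n n' c)}"
    unfolding codes_def l0_def below_def all_good by blast
  have "definable1 codes"
    unfolding codes_eq definable1_def good_def mem_Collect_eq
    by (intro env_definable_intros assms(1) le_def' succ_def' new_def')
  moreover define E where "E n c \<longleftrightarrow> (\<exists>n' m m'. succ n n' \<and> new n n' c m \<and> new n n' c m' \<and> m < m')"
    for n c
  have "definable2 E"
    unfolding definable2_def E_def by (intro env_definable_intros succ_def' new_def')
  moreover have "E (l i) c \<longleftrightarrow> i \<in> decode c" if "c \<in> codes" for c i
  proof -
    have "card (fresh i c) \<in> {1, 2}" using that unfolding codes_def by blast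
    from card_two_iff[OF this] show ?thesis unfolding E_def decode_def succ new[symmetric]
      using new by simp
  qed
  moreover have "definable2 (\<lambda>x y. \<exists>i. x = l i \<and> y = l (Suc i))"
    using succ2 unfolding succ_eq[abs_def] .
  ultimately show ?thesis
    using defines_B_from_coding[OF _ N' _ _ _ bij_decode, of E] strict_mono_imp_inj_on[OF mono] by blast
qed

end

section \<open>From families of finite sets to chains of finite sets\<close>

definition dense_between :: "real \<Rightarrow> real \<Rightarrow> real set \<Rightarrow> bool" where
  "dense_between a b X \<longleftrightarrow> a < b \<and> (\<forall>x y. a < x \<longrightarrow> x < y \<longrightarrow> y < b \<longrightarrow> (\<exists>z\<in>X. x < z \<and> z < y))"

text \<open>
  The interval \<open>(x, y)\<close> may touch the ends \<open>a\<close> and \<open>b\<close>: its middle third does not.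
\<close>
lemma dense_betweenD:
  assumes "dense_between a b X" "a \<le> x" "x < y" "y \<le> b"
  obtains z where "z \<in> X" "x < z" "z < y"
proof -
  let ?x = "(2 * x + y) / 3" and ?y = "(x + 2 * y) / 3"
  have "a < ?x" "?x < ?y" "?y < b" "x < ?x" "?y < y" using assms(2-4) by auto
  then obtain z where "z \<in> X" "?x < z" "z < ?y"
    using assms(1) unfolding dense_between_def by blast
  then show ?thesis using \<open>x < ?x\<close> \<open>?y < y\<close> by (intro that[of z]) linarith+
qed

lemma somewhere_dense_imp_dense_between:
  assumes "somewhere_dense X"
  obtains a b where "dense_between a b X"
proof -
  obtain I where I: "open I" "I \<noteq> {}" "I \<subseteq> closure (X \<inter> I)"
    using assms unfolding somewhere_dense_def by blast
  then obtain c e where e: "0 < e" "ball c e \<subseteq> I"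
    unfolding open_contains_ball by blast
  have "\<exists>z\<in>X. x < z \<and> z < y" if xy: "c - e < x" "x < y" "y < c + e" for x y
  proof -
    have "(x + y) / 2 \<in> ball c e" using xy by (auto simp: dist_real_def abs_less_iff field_simps)
    then have "(x + y) / 2 \<in> closure (X \<inter> I)" using e(2) I(3) by blast
    moreover have "0 < (y - x) / 2" using xy by simp
    ultimately obtain z where z: "z \<in> X \<inter> I" "dist z ((x + y) / 2) < (y - x) / 2"
      unfolding closure_approachable by blast
    then have "x < z" "z < y" by (auto simp: dist_real_def abs_less_iff field_simps)
    then show ?thesis using z(1) by blast
  qed
  then have "dense_between (c - e) (c + e) X" unfolding dense_between_def using e(1) by simp
  then show ?thesis by (rule that)
qed

context ordered_group_expansion
begin

text \<open>
  A point comes before another one if it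
  belongs to every set of the chain that contains the other one; what has come by the time of a
  point lies in each finite set that contains the point.
\<close>
lemma defines_B_if_dense_finite_chain:
  fixes F :: "real \<Rightarrow> real set"
  assumes "definable2 (\<lambda>s y. y \<in> F s)"
    and fin: "\<And>s. finite (F s)"
    and chain: "\<And>s t. F s \<subseteq> F t \<or> F t \<subseteq> F s"
    and dense: "dense_between a b (\<Union>s. F s)"
  shows "defines_B M"
proof -
  note F = env_definable_rel2[OF assms(1)]
  define S where "S = {y. a < y \<and> y < b \<and> (\<exists>s. y \<in> F s)}"
  define le where "le x y \<longleftrightarrow> (\<forall>s. y \<in> F s \<longrightarrow> x \<in> F s)" for x y
  have "definable1 S"
    unfolding definable1_def S_def mem_Collect_eq by (intro env_definable_intros F)
  moreover have "definable2 le"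
    unfolding definable2_def le_def by (intro env_definable_intros F)
  moreover have "dense_finitary_preorder S le a b"
  proof
    show "le x y \<or> le y x" for x y
      unfolding le_def using chain by blast
    show "le x z" if "le x y" "le y z" for x y z
      using that unfolding le_def by blast
    show "finite {x \<in> S. le x y}" if y: "y \<in> S" for y
    proof -
      obtain s where "y \<in> F s" using y unfolding S_def by blast
      then have "{x \<in> S. le x y} \<subseteq> F s" unfolding le_def by blast
      then show ?thesis using fin finite_subset by blast
    qed
    show "a < b" using dense unfolding dense_between_def by blast
    show "S \<subseteq> {a<..<b}" unfolding S_def by auto
    show "\<exists>z\<in>S. x < z \<and> z < y" if "a \<le> x" "x < y" "y \<le> b" for x y
    proof -
      obtain z where "z \<in> (\<Union>s. F s)" "x < z" "z < y" using dense_betweenD[OF dense \<open>a \<le> x\<close> \<open>x < y\<close> \<open>y \<le> b\<close>] .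
      then show ?thesis using that unfolding S_def by (intro bexI[of _ z]) auto
    qed
  qed
  ultimately show ?thesis by (rule defines_B_if_dense_finitary_preorder)
qed

end

definition has_gap :: "real \<Rightarrow> real \<Rightarrow> real set \<Rightarrow> real \<Rightarrow> bool" where
  "has_gap a b X \<eta> \<longleftrightarrow> (\<exists>u. a \<le> u \<and> u + \<eta> \<le> b \<and> (\<forall>y. y \<in> X \<longrightarrow> \<not> (u < y \<and> y < u + \<eta>)))"

lemma has_gap_antimono: "\<lbrakk>has_gap a b Y \<eta>; X \<subseteq> Y; \<eta>' \<le> \<eta>\<rbrakk> \<Longrightarrow> has_gap a b X \<eta>'"
  unfolding has_gap_def by (elim exE, rule exI) force

lemma has_gap_if_not_dense:
  assumes "a < b" "\<not> dense_between a b X"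
  obtains \<eta> where "0 < \<eta>" "has_gap a b X \<eta>"
proof -
  obtain x y where xy: "a < x" "x < y" "y < b" "\<And>z. z \<in> X \<Longrightarrow> \<not> (x < z \<and> z < y)"
    using assms unfolding dense_between_def by blast
  then have "has_gap a b X (y - x)" unfolding has_gap_def by (intro exI[of _ x]) auto
  with that[of "y - x"] xy(2) show ?thesis by simp
qed

text \<open>
  The sets grow when \<open>t\<close> decreases and when \<open>R\<close> increases. For \<open>t \<le> 0\<close> they may be infinite.
\<close>
locale finite_family =
  fixes A :: "real \<Rightarrow> real \<Rightarrow> real set" and a b :: real
  assumes finite_A: "0 < t \<Longrightarrow> finite (A t R)"
    and A_mono: "\<lbrakk>t' \<le> t; R \<le> R'\<rbrakk> \<Longrightarrow> A t R \<subseteq> A t' R'"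
    and dense_A: "dense_between a b (\<Union>t\<in>{0<..}. \<Union>R. A t R)"
begin

text \<open>
  Divide the interval into finitely many pieces of length \<open>\<eta> / 2\<close>.  A single set of the family meets
  all of them, by density and monotonicity, and every interval of length \<open>\<eta>\<close> contains one of them.
\<close>
lemma small_mesh:
  assumes "0 < \<eta>"
  obtains t R where "0 < t" "\<not> has_gap a b (A t R) \<eta>"
proof -
  define \<delta> where "\<delta> = \<eta> / 2"
  have \<delta>: "0 < \<delta>" using assms unfolding \<delta>_def by simp
  \<comment> \<open>The set \<open>X\<close> meets the piece with number \<open>j\<close> if this piece lies inside \<open>[a, b]\<close>.\<close>
  let ?meets = "\<lambda>X j. a + (real j + 1) * \<delta> \<le> b \<longrightarrow>
      (\<exists>z\<in>X. a + real j * \<delta> < z \<and> z < a + (real j + 1) * \<delta>)"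
  have "\<exists>t>0. \<exists>R. \<forall>j<n. ?meets (A t R) j" for n :: nat
  proof (induction n)
    case 0
    then show ?case by (intro exI[of _ 1]) simp
  next
    case (Suc n)
    then obtain t R where tR: "0 < t" "\<And>j. j < n \<Longrightarrow> ?meets (A t R) j" by blast
    have "\<exists>t'>0. \<exists>R'. ?meets (A t' R') n"
    proof (cases "a + (real n + 1) * \<delta> \<le> b")
      case True
      have "a \<le> a + real n * \<delta>" "a + real n * \<delta> < a + (real n + 1) * \<delta>"
        using \<delta> by (simp_all add: algebra_simps)
      then obtain z where "z \<in> (\<Union>t\<in>{0<..}. \<Union>R. A t R)" "a + real n * \<delta> < z"
        "z < a + (real n + 1) * \<delta>"
        using dense_betweenD[OF dense_A] True by blast
      then show ?thesis by blast
    next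
      case False
      then show ?thesis by (intro exI[of _ 1]) simp
    qed
    then obtain t' R' where tR': "0 < t'" "?meets (A t' R') n" by blast
    have "A t R \<subseteq> A (min t t') (max R R')" "A t' R' \<subseteq> A (min t t') (max R R')"
      by (rule A_mono; simp)+
    then have "?meets (A (min t t') (max R R')) j" if "j < Suc n" for j
      using tR(2)[of j] tR'(2) that by (cases "j = n") (blast, force)
    then show ?case using tR(1) tR'(1) by (intro exI[of _ "min t t'"]) auto
  qed
  then obtain t R where t: "0 < t" and meets: "\<And>j. j < nat \<lceil>(b - a) / \<delta>\<rceil> \<Longrightarrow> ?meets (A t R) j"
    by blast
  have "\<not> has_gap a b (A t R) \<eta>"
  proof
    assume "has_gap a b (A t R) \<eta>"
    then obtain u where u: "a \<le> u" "u + \<eta> \<le> b" "\<And>y. y \<in> A t R \<Longrightarrow> \<not> (u < y \<and> y < u + \<eta>)"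
      unfolding has_gap_def by blast
    \<comment> \<open>The first piece that starts at or after \<open>u\<close>.\<close>
    define j where "j = nat \<lceil>(u - a) / \<delta>\<rceil>"
    have "0 \<le> (u - a) / \<delta>" using u(1) \<delta> by simp
    then have "real j = of_int \<lceil>(u - a) / \<delta>\<rceil>" unfolding j_def by simp
    then have "(u - a) / \<delta> \<le> real j" "real j < (u - a) / \<delta> + 1" by linarith+
    then have j: "u - a \<le> real j * \<delta>" "real j * \<delta> < u - a + \<delta>"
      using \<delta> by (simp_all add: field_simps)
    moreover have "(real j + 1) * \<delta> = real j * \<delta> + \<delta>" by (simp add: algebra_simps)
    moreover have "\<eta> = \<delta> + \<delta>" unfolding \<delta>_def by simp
    ultimately have jb: "a + (real j + 1) * \<delta> \<le> u + \<eta>" by linarith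
    then have "(real j + 1) * \<delta> \<le> b - a" using u(2) by simp
    then have "real j + 1 \<le> (b - a) / \<delta>" using \<delta> by (simp add: field_simps)
    then have "j < nat \<lceil>(b - a) / \<delta>\<rceil>" by linarith
    from meets[OF this] obtain z where "z \<in> A t R" "a + real j * \<delta> < z" "z < a + (real j + 1) * \<delta>"
      using jb u(2) by force
    then show False using u(3)[of z] j(1) jb by linarith
  qed
  with t show ?thesis by (rule that)
qed

text \<open>
  Suppose that the union over all \<open>R\<close> is never dense between \<open>a\<close> and \<open>b\<close>, for any \<open>t > 0\<close>, nor is the
  union over all \<open>t\<close>, for any \<open>R\<close>.  Then the former union has a gap of
  positive length for each \<open>t\<close>, the latter one for each \<open>R\<close>, and the lengths of these gaps tend to
  zero in the direction in which the family grows.  They make the two parameters comparable: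
  the set collects the points that appear for a pair \<open>(t, R)\<close> for which both unions have a gap of
  length \<open>\<eta>\<close>.
\<close>
definition coarse :: "real \<Rightarrow> real set" where
  "coarse \<eta> = {y. 0 < \<eta> \<and> (\<exists>t R. 0 < t \<and> y \<in> A t R \<and>
      has_gap a b {y. \<exists>R. y \<in> A t R} \<eta> \<and> has_gap a b {y. \<exists>t. 0 < t \<and> y \<in> A t R} \<eta>)}"

text \<open>
  If a set \<open>A t\<^sub>0 R\<^sub>0\<close> has no gap of length \<open>\<eta>\<close>, the gap condition for \<open>t\<close> forces \<open>t\<^sub>0 \<le> t\<close> and the
  one for \<open>R\<close> forces \<open>R \<le> R\<^sub>0\<close>.
\<close>
lemma finite_coarse: "finite (coarse \<eta>)"
proof (cases "0 < \<eta>")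
  case True
  then obtain t\<^sub>0 R\<^sub>0 where 0: "0 < t\<^sub>0" "\<not> has_gap a b (A t\<^sub>0 R\<^sub>0) \<eta>" by (rule small_mesh)
  have "coarse \<eta> \<subseteq> A t\<^sub>0 R\<^sub>0"
  proof
    fix y assume "y \<in> coarse \<eta>"
    then obtain t R where y: "0 < t" "y \<in> A t R" and gap: "has_gap a b {y. \<exists>R. y \<in> A t R} \<eta>"
      "has_gap a b {y. \<exists>t. 0 < t \<and> y \<in> A t R} \<eta>"
      unfolding coarse_def by blast
    have "t\<^sub>0 \<le> t"
    proof (rule ccontr)
      assume "\<not> t\<^sub>0 \<le> t"
      then have "A t\<^sub>0 R\<^sub>0 \<subseteq> {y. \<exists>R. y \<in> A t R}" using A_mono[of t t\<^sub>0 R\<^sub>0 R\<^sub>0] by auto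
      with 0(2) has_gap_antimono[OF gap(1)] show False by simp
    qed
    moreover have "R \<le> R\<^sub>0"
    proof (rule ccontr)
      assume "\<not> R \<le> R\<^sub>0"
      then have "A t\<^sub>0 R\<^sub>0 \<subseteq> {y. \<exists>t. 0 < t \<and> y \<in> A t R}" using A_mono[of t\<^sub>0 t\<^sub>0 R\<^sub>0 R] 0(1) by auto
      with 0(2) has_gap_antimono[OF gap(2)] show False by simp
    qed
    ultimately show "y \<in> A t\<^sub>0 R\<^sub>0" using A_mono y(2) by blast
  qed
  then show ?thesis using finite_A[OF 0(1)] finite_subset by blast
next
  case False
  then show ?thesis unfolding coarse_def by simp
qed

lemma coarse_antimono: "\<lbrakk>0 < \<eta>'; \<eta>' \<le> \<eta>\<rbrakk> \<Longrightarrow> coarse \<eta> \<subseteq> coarse \<eta>'"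
  unfolding coarse_def using has_gap_antimono[OF _ subset_refl] by blast

lemma coarse_chain: "coarse \<eta> \<subseteq> coarse \<eta>' \<or> coarse \<eta>' \<subseteq> coarse \<eta>"
proof (cases "0 < \<eta> \<and> 0 < \<eta>'")
  case True
  then show ?thesis using coarse_antimono[of \<eta> \<eta>'] coarse_antimono[of \<eta>' \<eta>] by linarith
next
  case False
  then show ?thesis unfolding coarse_def by auto
qed

lemma dense_coarse:
  assumes "\<And>t. 0 < t \<Longrightarrow> \<not> dense_between a b {y. \<exists>R. y \<in> A t R}"
    and "\<And>R. \<not> dense_between a b {y. \<exists>t. 0 < t \<and> y \<in> A t R}"
  shows "dense_between a b (\<Union>\<eta>. coarse \<eta>)"
proof -
  have "a < b" using dense_A unfolding dense_between_def by blast
  have "y \<in> (\<Union>\<eta>. coarse \<eta>)" if y: "0 < t" "y \<in> A t R" for t R y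
  proof -
    obtain \<eta> where \<eta>: "0 < \<eta>" "has_gap a b {y. \<exists>R. y \<in> A t R} \<eta>"
      using has_gap_if_not_dense[OF \<open>a < b\<close> assms(1)[OF y(1)]] .
    obtain \<eta>' where \<eta>': "0 < \<eta>'" "has_gap a b {y. \<exists>t. 0 < t \<and> y \<in> A t R} \<eta>'"
      using has_gap_if_not_dense[OF \<open>a < b\<close> assms(2)] .
    have "has_gap a b {y. \<exists>R. y \<in> A t R} (min \<eta> \<eta>')"
      by (rule has_gap_antimono[OF \<eta>(2)]) auto
    moreover have "has_gap a b {y. \<exists>t. 0 < t \<and> y \<in> A t R} (min \<eta> \<eta>')"
      by (rule has_gap_antimono[OF \<eta>'(2)]) auto
    ultimately have "y \<in> coarse (min \<eta> \<eta>')"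
      unfolding coarse_def using y \<eta>(1) \<eta>'(1) by auto
    then show ?thesis by blast
  qed
  then have "(\<Union>t\<in>{0<..}. \<Union>R. A t R) \<subseteq> (\<Union>\<eta>. coarse \<eta>)" by blast
  then show ?thesis using dense_A unfolding dense_between_def by (meson subsetD)
qed

end

context ordered_group_expansion
begin

text \<open>
  If one parameter can be fixed, the other one indexes a chain; otherwise the lengths of gaps do.
\<close>
lemma defines_B_if_dense_finite_family:
  assumes "finite_family A a b" and "definable3 (\<lambda>t R y. y \<in> A t R)"
  shows "defines_B M"
proof -
  interpret finite_family A a b by (rule assms(1))
  note A = env_definable_rel3[OF assms(2)]
  consider (bounded) R a' b' where "dense_between a' b' {y. \<exists>t. 0 < t \<and> y \<in> A t R}"
    | (separated) t a' b' where "0 < t" "dense_between a' b' {y. \<exists>R. y \<in> A t R}"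
    | (neither) "\<And>R. \<not> dense_between a b {y. \<exists>t. 0 < t \<and> y \<in> A t R}"
      "\<And>t. 0 < t \<Longrightarrow> \<not> dense_between a b {y. \<exists>R. y \<in> A t R}"
    by blast
  then show ?thesis
  proof cases
    case bounded
    let ?F = "\<lambda>t. {y. 0 < t \<and> y \<in> A t R}"
    show ?thesis
    proof (rule defines_B_if_dense_finite_chain)
      show "definable2 (\<lambda>t y. y \<in> ?F t)"
        unfolding definable2_def mem_Collect_eq by (intro env_definable_intros A)
      show "finite (?F t)" for t using finite_A by (cases "0 < t") auto
      show "?F t \<subseteq> ?F t' \<or> ?F t' \<subseteq> ?F t" for t t'
        using A_mono[of t t' R R] A_mono[of t' t R R] by (cases "t \<le> t'") auto
      have "{y. \<exists>t. 0 < t \<and> y \<in> A t R} = (\<Union>t. ?F t)" by blast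
      with bounded show "dense_between a' b' (\<Union>t. ?F t)" by simp
    qed
  next
    case separated
    show ?thesis
    proof (rule defines_B_if_dense_finite_chain)
      show "definable2 (\<lambda>R y. y \<in> A t R)"
        unfolding definable2_def by (intro env_definable_intros A)
      show "finite (A t R)" for R using finite_A separated(1) by blast
      show "A t R \<subseteq> A t R' \<or> A t R' \<subseteq> A t R" for R R'
        using A_mono[of t t R R'] A_mono[of t t R' R] by linarith
      have "{y. \<exists>R. y \<in> A t R} = (\<Union>R. A t R)" by blast
      with separated(2) show "dense_between a' b' (\<Union>R. A t R)" by simp
    qed
  next
    case neither
    show ?thesis
    proof (rule defines_B_if_dense_finite_chain[OF _ finite_coarse coarse_chain dense_coarse])
      show "definable2 (\<lambda>\<eta> y. y \<in> coarse \<eta>)"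
        unfolding definable2_def coarse_def has_gap_def mem_Collect_eq
        by (intro env_definable_intros A)
    qed (use neither in auto)
  qed
qed

end

section \<open>Maps on discrete sets with somewhere dense image\<close>

text \<open>
  Distances are measured in the maximum norm, which addition and order can express.
\<close>
definition separated_by :: "nat \<Rightarrow> (nat \<Rightarrow> real) set \<Rightarrow> real \<Rightarrow> (nat \<Rightarrow> real) \<Rightarrow> bool" where
  "separated_by k D t d \<longleftrightarrow> (\<forall>d'\<in>Rpow k. d' \<in> D \<longrightarrow>
     (\<forall>i<k. d' i = d i) \<or> \<not> (\<forall>i<k. d' i < d i + t \<and> d i < d' i + t))"

definition in_cube :: "nat \<Rightarrow> real \<Rightarrow> (nat \<Rightarrow> real) \<Rightarrow> bool" where
  "in_cube k R d \<longleftrightarrow> (\<forall>i<k. d i < R \<and> 0 < R + d i)"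

lemma Rpow_eqI:
  assumes "x \<in> Rpow k" "y \<in> Rpow k" "\<And>i. i < k \<Longrightarrow> x i = y i"
  shows "x = y"
proof
  fix i show "x i = y i"
    using assms by (cases "i < k") (auto simp: topspace_Euclidean_space)
qed

text \<open>
  A basic neighbourhood in the product topology restricts finitely many coordinates. The relevant
  ones are the first \<open>k\<close>; on the others all points of \<open>\<real>\<^sup>k\<close> agree with \<open>d\<close>.
\<close>
lemma discrete_imp_separated_by:
  assumes "discrete_in_Rpow k D" "d \<in> D"
  obtains t where "0 < t" "separated_by k D t d"
proof -
  have "D \<subseteq> Rpow k" and "openin (subtopology (Euclidean_space k) D) {d}"
    using assms unfolding discrete_in_Rpow_def by auto
  then have "openin (subtopology (powertop_real UNIV) D) {d}"
    unfolding Euclidean_space_def subtopology_subtopology by (simp add: inf.absorb2)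
  then obtain T where T: "openin (powertop_real UNIV) T" "T \<inter> D = {d}"
    unfolding openin_subtopology by (metis Int_commute)
  then have "d \<in> T" by blast
  then obtain U where U: "finite {i. U i \<noteq> UNIV}" "\<And>i. open (U i)" "d \<in> Pi UNIV U"
    "Pi UNIV U \<subseteq> T"
    using T(1) unfolding openin_product_topology_alt by (auto simp: PiE_UNIV_domain)
  have "\<exists>t>0. ball (d i) t \<subseteq> U i" for i
    using U(2)[of i] U(3) unfolding open_contains_ball by (auto simp: Pi_def)
  then obtain t where t: "\<And>i. 0 < t i" "\<And>i. ball (d i) (t i) \<subseteq> U i" by metis
  \<comment> \<open>The element \<open>1\<close> keeps the set nonempty when \<open>k = 0\<close>.\<close>
  define r where "r = Min (insert 1 (t ` {..<k}))"
  have r: "0 < r" "\<And>i. i < k \<Longrightarrow> r \<le> t i"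
    unfolding r_def using t(1) by auto
  have "separated_by k D r d"
    unfolding separated_by_def
  proof (intro ballI impI)
    fix d' assume d': "d' \<in> Rpow k" "d' \<in> D"
    show "(\<forall>i<k. d' i = d i) \<or> \<not> (\<forall>i<k. d' i < d i + r \<and> d i < d' i + r)"
    proof (cases "\<forall>i<k. d' i < d i + r \<and> d i < d' i + r")
      case True
      have "d' i \<in> U i" for i
      proof (cases "i < k")
        case True
        then have "\<bar>d i - d' i\<bar> < r" using \<open>\<forall>i<k. d' i < d i + r \<and> d i < d' i + r\<close> by force
        then have "d' i \<in> ball (d i) (t i)" using r(2)[OF True] by (simp add: dist_real_def)
        then show ?thesis using t(2) by blast
      next
        case False
        then have "d' i = d i"
          using d'(1) assms(2) \<open>D \<subseteq> Rpow k\<close> by (auto simp: topspace_Euclidean_space)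
        then show ?thesis using U(3) by (auto simp: Pi_def)
      qed
      then have "d' \<in> T" using U(4) by (auto simp: Pi_def)
      then have "d' = d" using T(2) d'(2) by blast
      then show ?thesis by simp
    qed blast
  qed
  with r(1) show ?thesis by (rule that)
qed

text \<open>
  Divide the cube into finitely many cubes of side \<open>t\<close>: each contains at most one of the points.
\<close>
lemma finite_separated_by:
  assumes "D \<subseteq> Rpow k" "0 < t"
  shows "finite {d \<in> D. separated_by k D t d \<and> in_cube k R d}" (is "finite ?X")
proof -
  define g where "g d = restrict (\<lambda>i. \<lfloor>d i / t\<rfloor>) {..<k}" for d :: "nat \<Rightarrow> real"
  have "g ` ?X \<subseteq> (\<Pi>\<^sub>E i\<in>{..<k}. {\<lfloor>- R / t\<rfloor>..\<lfloor>R / t\<rfloor>})"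
  proof (clarify, rule PiE_I)
    fix d i assume "in_cube k R d" "i \<in> {..<k}"
    then have "d i < R" "- R < d i" unfolding in_cube_def by auto
    then have "- R / t \<le> d i / t" "d i / t \<le> R / t"
      using assms(2) divide_right_mono[of "- R" "d i" t] divide_right_mono[of "d i" R t] by simp_all
    then show "g d i \<in> {\<lfloor>- R / t\<rfloor>..\<lfloor>R / t\<rfloor>}"
      using \<open>i \<in> {..<k}\<close> unfolding g_def by (auto intro: floor_mono)
  qed (auto simp: g_def)
  then have "finite (g ` ?X)"
    by (rule finite_subset) (auto intro: finite_PiE)
  moreover have "inj_on g ?X"
  proof (rule inj_onI)
    fix d d' assume d: "d \<in> ?X" "d' \<in> ?X" "g d = g d'"
    have "d' i < d i + t \<and> d i < d' i + t" if "i < k" for i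
    proof -
      have "\<lfloor>d i / t\<rfloor> = \<lfloor>d' i / t\<rfloor>"
        using fun_cong[OF d(3), of i] that unfolding g_def by simp
      then have "d' i / t < d i / t + 1" "d i / t < d' i / t + 1" by linarith+
      then show ?thesis using assms(2) by (simp add: field_simps)
    qed
    then have "\<forall>i<k. d' i = d i"
      using d(1,2) assms(1) unfolding separated_by_def by blast
    then show "d = d'" using d assms(1) by (intro Rpow_eqI[of _ k]) auto
  qed
  ultimately show ?thesis using finite_imageD by blast
qed

lemma separated_by_antimono: "\<lbrakk>separated_by k D t d; t' \<le> t\<rbrakk> \<Longrightarrow> separated_by k D t' d"
  unfolding separated_by_def by (meson add_left_mono order_less_le_trans)

lemma in_cube_mono: "\<lbrakk>in_cube k R d; R \<le> R'\<rbrakk> \<Longrightarrow> in_cube k R' d"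
  unfolding in_cube_def by force

lemma in_cube_exists: "\<exists>R. in_cube k R d"
proof -
  have "in_cube k (1 + (\<Sum>i<k. \<bar>d i\<bar>)) d"
    unfolding in_cube_def
  proof (intro allI impI)
    fix i assume "i < k"
    then have "\<bar>d i\<bar> \<le> (\<Sum>i<k. \<bar>d i\<bar>)" by (intro member_le_sum) auto
    then show "d i < 1 + (\<Sum>i<k. \<bar>d i\<bar>) \<and> 0 < 1 + (\<Sum>i<k. \<bar>d i\<bar>) + d i" by linarith
  qed
  then show ?thesis ..
qed

lemma graph_iff:
  assumes "d \<in> Rpow k"
  shows "tuple_append k d (real_point y) \<in>
           (\<lambda>(x, y). tuple_append k x y) ` (\<lambda>x. (x, real_point (f x))) ` (D \<inter> Rpow k)
         \<longleftrightarrow> d \<in> D \<and> f d = y"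
proof
  assume "tuple_append k d (real_point y) \<in>
           (\<lambda>(x, y). tuple_append k x y) ` (\<lambda>x. (x, real_point (f x))) ` (D \<inter> Rpow k)"
  then obtain x where x: "x \<in> D" "x \<in> Rpow k"
    "tuple_append k d (real_point y) = tuple_append k x (real_point (f x))"
    by auto
  have "d i = x i" if "i < k" for i
    using fun_cong[OF x(3), of i] that by (simp add: tuple_append_def)
  then have "d = x" using assms x(2) by (intro Rpow_eqI[of _ k])
  moreover have "y = f x"
    using fun_cong[OF x(3), of k] by (simp add: tuple_append_def real_point_def)
  ultimately show "d \<in> D \<and> f d = y" using x(1) by simp
qed (use assms in auto)

context ordered_group_expansion
begin

lemma env_definable_all_tuple:
  assumes "env_definable (\<lambda>e. Q (\<lambda>i. e (i + k)) (truncate k e))"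
  shows "env_definable (\<lambda>e. \<forall>x\<in>Rpow k. Q e x)"
proof -
  have "env_definable (\<lambda>e. \<exists>x\<in>Rpow k. \<not> Q e x)"
    by (rule env_definable_ex_tuple, rule env_definable_not, rule assms)
  from env_definable_not[OF this] show ?thesis by simp
qed

lemma truncate_in_Rpow: "truncate k e \<in> Rpow k"
  by (simp add: Rpow_iff truncate_def)

lemma coordinate_truncate: "coordinate_or_constant (\<lambda>e. truncate k e i)"
  "coordinate_or_constant (\<lambda>e. truncate k (\<lambda>j. e (j + m)) i)"
  by (cases "i < k"; auto simp: truncate_def)+

text \<open>
  The point \<open>d\<close> occupies the coordinates below \<open>k\<close>, followed by \<open>t\<close>, \<open>R\<close> and \<open>y\<close>.
\<close>
lemma definable3_image:
  assumes "definable M k D" "D \<subseteq> Rpow k" "definable_map M k 1 D (\<lambda>x. real_point (f x))"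
  shows "definable3 (\<lambda>t R y. y \<in> f ` {d \<in> D. separated_by k D t d \<and> in_cube k R d})"
proof -
  let ?X = "(\<lambda>(x, y). tuple_append k x y) ` (\<lambda>x. (x, real_point (f x))) ` D"
  have X: "definable M (k + 1) ?X"
    using assms(3) unfolding definable_map_def definable_rel_def by blast
  have graph: "tuple_append k d (real_point y) \<in> ?X \<longleftrightarrow> d \<in> D \<and> f d = y" if "d \<in> Rpow k" for d y
    using graph_iff[OF that, of y f D] assms(2) by (simp add: inf.absorb1)
  have mem_D: "env_definable (\<lambda>e. truncate k e \<in> D)"
    using env_definable_if_definable[OF assms(1), of "\<lambda>i e. truncate k e i"]
      coordinate_truncate(1) truncate_in_Rpow by simp
  have in_graph: "env_definable (\<lambda>e. tuple_append k (truncate k e) (real_point (e (k + 2))) \<in> ?X)"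
  proof (rule env_definable_if_definable[OF X,
        of "\<lambda>i e. tuple_append k (truncate k e) (real_point (e (k + 2))) i"])
    show "coordinate_or_constant (\<lambda>e. tuple_append k (truncate k e) (real_point (e (k + 2))) i)" for i
      by (cases "i < k"; cases "i = k") (auto simp: tuple_append_def truncate_def real_point_def)
    show "tuple_append k (truncate k e) (real_point (e (k + 2))) \<in> Rpow (k + 1)" for e
      by (auto simp: Rpow_iff tuple_append_def real_point_def)
  qed
  have "env_definable (\<lambda>e. separated_by k D (e k) (truncate k e))"
    unfolding separated_by_def
    by (intro env_definable_all_tuple env_definable_imp mem_D env_definable_disj env_definable_not
          env_definable_ball_less env_definable_conj env_definable_eq env_definable_less_add
          coordinate_truncate coordinateI)
  moreover have "env_definable (\<lambda>e. in_cube k (e (k + 1)) (truncate k e))"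
    unfolding in_cube_def
    by (intro env_definable_ball_less env_definable_conj env_definable_less env_definable_less_add
          coordinate_truncate coordinateI constantI)
  ultimately have "env_definable (\<lambda>e. tuple_append k (truncate k e) (real_point (e (k + 2))) \<in> ?X \<and>
      separated_by k D (e k) (truncate k e) \<and> in_cube k (e (k + 1)) (truncate k e))"
    using in_graph by (intro env_definable_conj)
  then have "env_definable (\<lambda>e. \<exists>d\<in>Rpow k. tuple_append k d (real_point (e 2)) \<in> ?X \<and>
      separated_by k D (e 0) d \<and> in_cube k (e 1) d)"
    by (intro env_definable_ex_tuple) (simp only: add.commute[of _ k] add_0_right)
  moreover have "(\<exists>d\<in>Rpow k. tuple_append k d (real_point y) \<in> ?X \<and> separated_by k D t d \<and> in_cube k R d)
      \<longleftrightarrow> y \<in> f ` {d \<in> D. separated_by k D t d \<and> in_cube k R d}" for y t R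
  proof -
    have "(\<exists>d\<in>Rpow k. tuple_append k d (real_point y) \<in> ?X \<and> separated_by k D t d \<and> in_cube k R d)
        \<longleftrightarrow> (\<exists>d\<in>Rpow k. (d \<in> D \<and> f d = y) \<and> separated_by k D t d \<and> in_cube k R d)"
      by (rule bex_cong[OF refl]) (simp only: graph)
    also have "\<dots> \<longleftrightarrow> (\<exists>d. d \<in> D \<and> f d = y \<and> separated_by k D t d \<and> in_cube k R d)"
      using assms(2) by blast
    finally show ?thesis by blast
  qed
  ultimately show ?thesis unfolding definable3_def by (simp only:)
qed

end

theorem theoremC:
  fixes M :: "('f, 'r, real) fo_struct"
    and k :: nat
    and D :: "(nat \<Rightarrow> real) set"
    and f :: "(nat \<Rightarrow> real) \<Rightarrow> real"
  assumes "expands_real_ordered_group M"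
    and "definable M k D"
    and "discrete_in_Rpow k D"
    and "definable_map M k 1 D (\<lambda>x. real_point (f x))"
    and "somewhere_dense (f ` D)"
  shows "defines_B M"
proof -
  interpret ordered_group_expansion M
    by unfold_locales (rule assms(1))
  have D: "D \<subseteq> Rpow k" using assms(3) unfolding discrete_in_Rpow_def by blast
  define A where "A t R = f ` {d \<in> D. separated_by k D t d \<and> in_cube k R d}" for t R
  obtain a b where dense: "dense_between a b (f ` D)"
    using somewhere_dense_imp_dense_between[OF assms(5)] .
  have "f ` D = (\<Union>t\<in>{0<..}. \<Union>R. A t R)"
  proof (intro equalityI subsetI)
    fix y assume "y \<in> f ` D"
    then obtain d where d: "d \<in> D" "y = f d" by blast
    obtain t where t: "0 < t" "separated_by k D t d"
      using discrete_imp_separated_by[OF assms(3) d(1)] .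
    obtain R where "in_cube k R d" using in_cube_exists by blast
    then have "y \<in> A t R" unfolding A_def using d t(2) by blast
    then show "y \<in> (\<Union>t\<in>{0<..}. \<Union>R. A t R)" using t(1) by blast
  qed (auto simp: A_def)
  with dense have dense_A: "dense_between a b (\<Union>t\<in>{0<..}. \<Union>R. A t R)" by simp
  have "finite_family A a b"
  proof
    show "finite (A t R)" if "0 < t" for t R
      unfolding A_def by (rule finite_imageI) (rule finite_separated_by[OF D that])
    show "A t R \<subseteq> A t' R'" if "t' \<le> t" "R \<le> R'" for t t' R R'
    proof -
      have "{d \<in> D. separated_by k D t d \<and> in_cube k R d}
          \<subseteq> {d \<in> D. separated_by k D t' d \<and> in_cube k R' d}"
        using separated_by_antimono[OF _ that(1)] in_cube_mono[OF _ that(2)] by blast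
      then show ?thesis unfolding A_def by (rule image_mono)
    qed
  qed (rule dense_A)
  moreover have "definable3 (\<lambda>t R y. y \<in> A t R)"
    unfolding A_def using definable3_image[OF assms(2) D assms(4)] .
  ultimately show ?thesis by (rule defines_B_if_dense_finite_family)
qed

end
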